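(* Suppose that the system $\dot x=f(x;\mu)$, $(x,\mu)\in\mathbb R^{2n}\times\mathbb R$, $n\ge2$, $f$ analytic, satisfies assumptions (R1)-(R5) of the context with $n_0=1$. Then there exists an open interval $I\subset\mathbb R$ containing $\mu=0$ such that for $\mu\in I$ the system has a symmetric homoclinic orbit to the origin.
   Context: Assumptions: (R1) The system is reversible: there is a linear involution $R$ with $f(Rx;\mu)+Rf(x;\mu)=0$ for all $(x,\mu)\in\mathbb R^{2n}\times\mathbb R$, and $\dim\mathrm{Fix}(R)=n$, where $\mathrm{Fix}(R)=\{x\in\mathbb R^{2n}\mid Rx=x\}$. (R2) $f(0;\mu)=0$ for all $\mu\in\mathbb R$. (R3) $\mathrm D_xf(0;0)$ has $2n$ eigenvalues $\pm\lambda_1,\dots,\pm\lambda_n$ with $0<\mathrm{Re}\,\lambda_1\le\dots\le\mathrm{Re}\,\lambda_n$. (R4) At $\mu=0$ the equilibrium $x=0$ has a symmetric homoclinic orbit $x^{\mathrm h}(t)$ with $x^{\mathrm h}(0)\in\mathrm{Fix}(R)$. (R5) (with $n_0=1$) The variational equation $\dot\xi=\mathrm D_xf(x^{\mathrm h}(t);0)\xi$ on $\mathbb R$ has no bounded solution that is linearly independent of $\xi=\dot x^{\mathrm h}(t)$. A solution $x(t)$ (and its orbit) is symmetric if $x(t)=Rx(-t)$. *)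

theory Defs
  imports "HOL-Analysis.Analysis"
begin

text \<open>
  Real analyticity in several variables: near \<open>a\<close> the function is the sum of a power series
  indexed by multi-indices \<open>\<alpha>\<close>. These are functions on the coordinate directions \<open>Basis\<close>,
  and the monomial of \<open>\<alpha>\<close> is the product of the coordinates of \<open>x - a\<close> raised to the powers
  given by \<open>\<alpha>\<close>. The unordered sum expresses absolute convergence for finite-dimensional values.
\<close>

definition real_analytic_at ::
  "('a::euclidean_space \<Rightarrow> 'b::real_normed_vector) \<Rightarrow> 'a \<Rightarrow> bool" where
  "real_analytic_at f a \<longleftrightarrow>
     (\<exists>r>0. \<exists>c :: ('a \<Rightarrow> nat) \<Rightarrow> 'b. \<forall>x\<in>ball a r.
        ((\<lambda>\<alpha>. (\<Prod>b\<in>Basis. ((x - a) \<bullet> b) ^ \<alpha> b) *\<^sub>R c \<alpha>) has_sum f x)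
          (Basis \<rightarrow>\<^sub>E UNIV))"

text \<open>
  Complex eigenvalues of a real square matrix, listed with algebraic multiplicity, i.e. the roots
  of \<open>det (X I - A)\<close> over the complex numbers; \<open>[:0, 1:]\<close> is the indeterminate \<open>X\<close>.
\<close>

definition char_polynomial :: "real ^ 'm ^ 'm \<Rightarrow> complex poly" where
  "char_polynomial A = det (mat [:0, 1:] - map_matrix (\<lambda>a. [:complex_of_real a:]) A)"

definition eigenvalues :: "real ^ 'm ^ 'm \<Rightarrow> complex multiset" where
  "eigenvalues A = proots (char_polynomial A)"

definition fixed_space :: "('a \<Rightarrow> 'a) \<Rightarrow> 'a set" where
  "fixed_space R = {x. R x = x}"

definition solves_on_line :: "(real \<Rightarrow> 'a \<Rightarrow> 'a) \<Rightarrow> (real \<Rightarrow> 'a::real_normed_vector) \<Rightarrow> bool" where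
  "solves_on_line F x \<longleftrightarrow> (\<forall>t. (x has_vector_derivative F t (x t)) (at t))"

text \<open>A homoclinic orbit to the origin is in particular not the equilibrium itself.\<close>

definition homoclinic_to_origin :: "('a \<Rightarrow> 'a) \<Rightarrow> (real \<Rightarrow> 'a::real_normed_vector) \<Rightarrow> bool" where
  "homoclinic_to_origin g x \<longleftrightarrow>
     solves_on_line (\<lambda>t. g) x \<and> (\<exists>t. x t \<noteq> 0) \<and>
     (x \<longlongrightarrow> 0) at_top \<and> (x \<longlongrightarrow> 0) at_bot"

definition symmetric_solution :: "('a \<Rightarrow> 'a) \<Rightarrow> (real \<Rightarrow> 'a) \<Rightarrow> bool" where
  "symmetric_solution R x \<longleftrightarrow> (\<forall>t. x t = R (x (- t)))"

text \<open>
  Linear independence of two vector-valued functions as elements of the function space, with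
  constant coefficients (the function type carries no \<open>real_vector\<close> instance).
\<close>

definition lin_indep_functions ::
  "(real \<Rightarrow> 'a::real_vector) \<Rightarrow> (real \<Rightarrow> 'a) \<Rightarrow> bool" where
  "lin_indep_functions \<xi> \<eta> \<longleftrightarrow>
     (\<forall>a b. (\<forall>t. a *\<^sub>R \<xi> t + b *\<^sub>R \<eta> t = 0) \<longrightarrow> a = 0 \<and> b = 0)"

definition variational_solution ::
  "(real ^ 'm \<Rightarrow> real ^ 'm) \<Rightarrow> (real \<Rightarrow> real ^ 'm) \<Rightarrow> (real \<Rightarrow> real ^ 'm) \<Rightarrow> bool" where
  "variational_solution g x \<xi> \<longleftrightarrow> solves_on_line (\<lambda>t v. jacobian g (at (x t)) *v v) \<xi>"

end

theory Submission
  imports Defs "HOL-Computational_Algebra.Fundamental_Theorem_Algebra"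
begin

text \<open>
  Write the orbit sought at parameter \<open>\<mu>\<close> as \<open>x\<^sub>h + y\<close> with \<open>y\<close> small. Then \<open>y\<close> solves
  \<open>y' = A(t) y + g(t, y)\<close> on the whole line, where \<open>A(t)\<close> is the Jacobian of \<open>f( \<cdot> ; 0)\<close> at
  \<open>x\<^sub>h(t)\<close> and the remainder \<open>g\<close> has a small Lipschitz constant in \<open>y\<close> near \<open>0\<close> and is small at
  \<open>y = 0\<close> when \<open>\<mu>\<close> is small. If the linear problem \<open>y' = A(t) y + h\<close> can be solved with a bound
  \<open>\<parallel>y\<parallel> \<le> C \<parallel>h\<parallel>\<close>, the contraction principle yields \<open>y\<close>. On all
  bounded functions uniqueness fails, because \<open>x\<^sub>h'\<close> solves the homogeneous equation. It is
  restored within the reversible class, \<open>h(-t) = -R h(t)\<close> and \<open>y(-t) = R y(t)\<close>: a bounded solution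
  of the variational equation is a multiple of \<open>x\<^sub>h'\<close>, and \<open>x\<^sub>h'(-t) = -R x\<^sub>h'(t)\<close> has the wrong
  symmetry.

  It remains to pass from injectivity to bounded invertibility. The limit of \<open>A(t)\<close> at both ends
  is the same hyperbolic matrix \<open>A\<^sub>0\<close>, the Jacobian at the origin, so \<open>A(t) = A\<^sub>0 + B(t)\<close> with
  \<open>B \<longlongrightarrow> 0\<close> at \<open>\<plusminus>\<infinity>\<close>. The operator \<open>y \<mapsto> y' - A\<^sub>0 y\<close> has a bounded inverse on the bounded
  continuous functions on the line (\<open>hyperbolic_solution_operator\<close>). The full equation then reads
  \<open>y = K y + u\<close> with \<open>K\<close> this inverse composed with multiplication by \<open>B\<close> and with symmetrization.
  The functions \<open>K y\<close>, \<open>\<parallel>y\<parallel> \<le> 1\<close>, are uniformly Lipschitz and uniformly small near \<open>\<plusminus>\<infinity>\<close>, so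
  \<open>K\<close> is of finite rank up to an error of norm at most \<open>1/2\<close>, and the Fredholm alternative applies
  (\<open>finite_rank_perturbation_invertible\<close>, \<open>bounded_symmetric_solution\<close>). One inverse on the whole
  line thus replaces the intersection of stable and unstable manifolds.

  The inverse for \<open>A\<^sub>0\<close> comes from scalar equations by Putzer's scheme: if a product
  \<open>(A\<^sub>0 - l\<^sub>1) \<dots> (A\<^sub>0 - l\<^sub>m)\<close> vanishes with all \<open>l\<^sub>i\<close> off the imaginary axis, solve
  \<open>g' = l\<^sub>1 g + k\<close> and continue with the source \<open>(A\<^sub>0 - l\<^sub>1) g\<close>, which the remaining factors
  annihilate (\<open>bounded_solution_by_factors\<close>). All bounds are stated against slowly varying
  weights \<open>\<omega>\<close>: taking \<open>\<omega>\<close> constant gives boundedness, and \<open>\<omega>(t) = \<epsilon> + C exp (-\<eta> \<bar>t\<bar>)\<close>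
  gives decay at infinity with uniform control.

  Analyticity of \<open>f\<close> enters through strict differentiability at every point, which is the
  Lipschitz estimate that the remainder \<open>g\<close> needs.
\<close>

section \<open>Strict differentiability of analytic maps\<close>

text \<open>
  The estimate compares two arbitrary points near \<open>a\<close>, not a point with \<open>a\<close>: \<open>F - L\<close> has
  arbitrarily small Lipschitz constants near \<open>a\<close>. Strict differentiability at every point amounts
  to continuous differentiability.
\<close>
definition strict_derivative_at ::
  "('a::real_normed_vector \<Rightarrow> 'b::real_normed_vector) \<Rightarrow> ('a \<Rightarrow> 'b) \<Rightarrow> 'a \<Rightarrow> bool" where
  "strict_derivative_at F L a \<longleftrightarrow> bounded_linear L \<and>
     (\<forall>e>0. \<exists>d>0. \<forall>x\<in>ball a d. \<forall>y\<in>ball a d. norm (F x - F y - L (x - y)) \<le> e * norm (x - y))"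

lemma strict_derivativeE:
  assumes "strict_derivative_at F L a" "e > 0"
  obtains d where "d > 0"
    "\<And>x y. norm (x - a) < d \<Longrightarrow> norm (y - a) < d \<Longrightarrow> norm (F x - F y - L (x - y)) \<le> e * norm (x - y)"
  using assms unfolding strict_derivative_at_def
  by (metis dist_norm mem_ball norm_minus_commute)

lemma strict_derivative_has_derivative:
  assumes "strict_derivative_at F L a"
  shows "(F has_derivative L) (at a)"
  unfolding has_derivative_at_alt
proof (intro conjI allI impI)
  show "bounded_linear L" using assms by (simp add: strict_derivative_at_def)
  fix e :: real assume "e > 0"
  then obtain d where "d > 0" and
    d: "\<And>x y. norm (x - a) < d \<Longrightarrow> norm (y - a) < d \<Longrightarrow> norm (F x - F y - L (x - y)) \<le> e * norm (x - y)"
    using assms strict_derivativeE by metis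
  then show "\<exists>d>0. \<forall>y. norm (y - a) < d \<longrightarrow> norm (F y - F a - L (y - a)) \<le> e * norm (y - a)"
    by (intro exI[of _ d]) auto
qed

text \<open>
  Coordinatewise this is the equivalence of both kinds of summability for real families.
\<close>
lemma summable_on_imp_abs_summable_on:
  fixes f :: "'i \<Rightarrow> 'b::euclidean_space"
  assumes "f summable_on A"
  shows "(\<lambda>i. norm (f i)) summable_on A"
proof -
  have "(\<lambda>i. f i \<bullet> b) summable_on A" for b
    using summable_on_bounded_linear[OF bounded_linear_inner_left assms] by simp
  then have "(\<lambda>i. \<bar>f i \<bullet> b\<bar>) summable_on A" for b
    using summable_on_iff_abs_summable_on_real by fastforce
  then have "(\<lambda>i. \<Sum>b\<in>S. \<bar>f i \<bullet> b\<bar>) summable_on A" for S :: "'b set"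
    by (induction S rule: infinite_finite_induct) (auto intro: summable_on_add)
  then show ?thesis
    by (rule summable_on_comparison_test) (auto intro: norm_le_l1)
qed

text \<open>
  Dividing by \<open>\<rho>\<close> moves all coordinates into \<open>[-1, 1]\<close>, where the difference of two
  products is at most the sum of the differences of the factors. The factor \<open>\<rho>\<close> on the left
  stands for the exponent \<open>\<Sum> \<alpha> - 1\<close>, which truncated subtraction would spoil for \<open>\<alpha> = 0\<close>.
\<close>
lemma monomial_difference_bound:
  fixes u v :: "'i \<Rightarrow> real"
  assumes "\<rho> > 0" "\<And>b. b \<in> B \<Longrightarrow> \<bar>u b\<bar> \<le> \<rho>" "\<And>b. b \<in> B \<Longrightarrow> \<bar>v b\<bar> \<le> \<rho>"
    "\<And>b. b \<in> B \<Longrightarrow> \<bar>u b - v b\<bar> \<le> D"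
  shows "\<bar>(\<Prod>b\<in>B. u b ^ \<alpha> b) - (\<Prod>b\<in>B. v b ^ \<alpha> b)\<bar> * \<rho> \<le> real (\<Sum>b\<in>B. \<alpha> b) * \<rho> ^ (\<Sum>b\<in>B. \<alpha> b) * D"
proof -
  let ?k = "\<Sum>b\<in>B. \<alpha> b"
  have scale: "(\<Prod>b\<in>B. w b ^ \<alpha> b) = \<rho> ^ ?k * (\<Prod>b\<in>B. (w b / \<rho>) ^ \<alpha> b)" for w :: "'i \<Rightarrow> real"
    using \<open>\<rho> > 0\<close> by (simp add: power_sum flip: prod.distrib power_mult_distrib)
  have le1: "norm (u b / \<rho>) \<le> 1" "norm (v b / \<rho>) \<le> 1" if "b \<in> B" for b
    using assms that by auto
  have "norm ((\<Prod>b\<in>B. (u b / \<rho>) ^ \<alpha> b) - (\<Prod>b\<in>B. (v b / \<rho>) ^ \<alpha> b))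
      \<le> (\<Sum>b\<in>B. norm ((u b / \<rho>) ^ \<alpha> b - (v b / \<rho>) ^ \<alpha> b))"
    by (intro norm_prod_diff) (use le1 in \<open>auto simp: norm_power power_le_one simp del: real_norm_def norm_divide\<close>)
  also have "\<dots> \<le> (\<Sum>b\<in>B. real (\<alpha> b) * (D / \<rho>))"
  proof (intro sum_mono)
    fix b assume b: "b \<in> B"
    have "norm ((u b / \<rho>) ^ \<alpha> b - (v b / \<rho>) ^ \<alpha> b) \<le> \<alpha> b * norm (u b / \<rho> - v b / \<rho>)"
      using le1[OF b] by (intro norm_power_diff) auto
    also have "norm (u b / \<rho> - v b / \<rho>) \<le> D / \<rho>"
      using assms(1) assms(4)[OF b] by (simp add: divide_right_mono flip: diff_divide_distrib)
    finally show "norm ((u b / \<rho>) ^ \<alpha> b - (v b / \<rho>) ^ \<alpha> b) \<le> real (\<alpha> b) * (D / \<rho>)"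
      by (simp add: mult_left_mono)
  qed
  also have "\<dots> = real ?k * D / \<rho>" by (simp add: sum_distrib_right sum_divide_distrib)
  finally have *: "\<bar>(\<Prod>b\<in>B. (u b / \<rho>) ^ \<alpha> b) - (\<Prod>b\<in>B. (v b / \<rho>) ^ \<alpha> b)\<bar> \<le> real ?k * D / \<rho>" by simp
  have "\<bar>(\<Prod>b\<in>B. u b ^ \<alpha> b) - (\<Prod>b\<in>B. v b ^ \<alpha> b)\<bar>
      = \<rho> ^ ?k * \<bar>(\<Prod>b\<in>B. (u b / \<rho>) ^ \<alpha> b) - (\<Prod>b\<in>B. (v b / \<rho>) ^ \<alpha> b)\<bar>"
    using \<open>\<rho> > 0\<close> unfolding scale[of u] scale[of v] right_diff_distrib[symmetric] abs_mult by simp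
  also have "\<dots> \<le> \<rho> ^ ?k * (real ?k * D / \<rho>)"
    using * \<open>\<rho> > 0\<close> by (intro mult_left_mono) auto
  finally show ?thesis
    using \<open>\<rho> > 0\<close> by (simp add: field_simps)
qed

text \<open>
  The linear part \<open>L\<close> collects the terms of degree one. The terms of degree at least two have
  Lipschitz constants of order \<open>\<rho>\<close> on the ball of radius \<open>\<rho>\<close>, uniformly summable because the series
  converges absolutely at a point \<open>p\<close> such that all coordinates of \<open>p - a\<close> equal \<open>s\<close>.
\<close>
lemma real_analytic_strict_derivative:
  fixes F :: "'a::euclidean_space \<Rightarrow> 'b::euclidean_space"
  assumes "real_analytic_at F a"
  shows "\<exists>L. strict_derivative_at F L a"
proof -
  obtain r c where "r > 0" and F: "\<And>x. x \<in> ball a r \<Longrightarrow>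
      ((\<lambda>\<alpha>. (\<Prod>b\<in>Basis. ((x - a) \<bullet> b) ^ \<alpha> b) *\<^sub>R c \<alpha>) has_sum F x) (Basis \<rightarrow>\<^sub>E UNIV)"
    using assms unfolding real_analytic_at_def by blast
  define J where "J = (Basis \<rightarrow>\<^sub>E UNIV :: ('a \<Rightarrow> nat) set)"
  define m where "m = (\<lambda>(\<alpha> :: 'a \<Rightarrow> nat) v. \<Prod>b\<in>Basis. (v \<bullet> b) ^ \<alpha> b)"
  define deg where "deg = (\<lambda>\<alpha> :: 'a \<Rightarrow> nat. \<Sum>b\<in>Basis. \<alpha> b)"
  define lin where "lin = (\<lambda>(\<alpha> :: 'a \<Rightarrow> nat) v. \<Sum>b\<in>Basis. real (\<alpha> b) * (v \<bullet> b))"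
  define J1 where "J1 = {\<alpha> \<in> J. deg \<alpha> = 1}"
  define L where "L = (\<lambda>v. \<Sum>\<alpha>\<in>J1. lin \<alpha> v *\<^sub>R c \<alpha>)"
  define T where "T = (\<lambda>\<alpha> x y. (m \<alpha> (x - a) - m \<alpha> (y - a) - (if deg \<alpha> = 1 then lin \<alpha> (x - y) else 0)) *\<^sub>R c \<alpha>)"
  have "J1 \<subseteq> Basis \<rightarrow>\<^sub>E {0,1}"
  proof
    fix \<alpha> assume "\<alpha> \<in> J1"
    then have *: "\<alpha> \<in> J" "(\<Sum>b\<in>Basis. \<alpha> b) = 1" by (auto simp: J1_def deg_def)
    then have "\<alpha> b \<le> 1" if "b \<in> Basis" for b
      using member_le_sum[of b Basis \<alpha>] that by simp
    then show "\<alpha> \<in> Basis \<rightarrow>\<^sub>E {0,1}"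
      using *(1) by (force simp: J_def PiE_iff le_Suc_eq)
  qed
  then have "finite J1" by (rule finite_subset) (auto intro: finite_PiE)
  have "bounded_linear L"
    unfolding L_def lin_def
    by (intro bounded_linear_sum bounded_linear_scaleR_const bounded_linear_const_mult bounded_linear_inner_left)
  have lin: "m \<alpha> v = lin \<alpha> v" if \<open>deg \<alpha> = 1\<close> for \<alpha> v
  proof -
    have "\<exists>a\<in>Basis. \<alpha> a = 1 \<and> (\<forall>b\<in>Basis. a \<noteq> b \<longrightarrow> \<alpha> b = 0)"
      using that iffD1[OF sum_eq_1_iff[OF finite_Basis], of \<alpha>] unfolding deg_def by simp
    then obtain b0 where b0: "b0 \<in> Basis" "\<alpha> b0 = 1" "\<And>b. b \<in> Basis \<Longrightarrow> b \<noteq> b0 \<Longrightarrow> \<alpha> b = 0"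
      by metis
    have "m \<alpha> v = (v \<bullet> b0)"
      unfolding m_def using b0 by (subst prod.remove[OF _ b0(1)]) (auto intro!: prod.neutral)
    moreover have "lin \<alpha> v = (v \<bullet> b0)"
      unfolding lin_def using b0 by (subst sum.remove[OF _ b0(1)]) (auto intro!: sum.neutral)
    ultimately show ?thesis by simp
  qed
  have T: "((\<lambda>\<alpha>. T \<alpha> x y) has_sum F x - F y - L (x - y)) J" if "x \<in> ball a r" "y \<in> ball a r" for x y
  proof -
    have "((\<lambda>\<alpha>. lin \<alpha> (x - y) *\<^sub>R c \<alpha>) has_sum L (x - y)) J1"
      using \<open>finite J1\<close> unfolding L_def by (rule has_sum_finite)
    then have "((\<lambda>\<alpha>. (if deg \<alpha> = 1 then lin \<alpha> (x - y) else 0) *\<^sub>R c \<alpha>) has_sum L (x - y)) J"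
      by (rule has_sum_cong_neutral[THEN iffD1, rotated -1]) (auto simp: J1_def)
    then have "((\<lambda>\<alpha>. - ((if deg \<alpha> = 1 then lin \<alpha> (x - y) else 0) *\<^sub>R c \<alpha>)) has_sum - L (x - y)) J"
      by (simp only: has_sum_uminus minus_minus)
    moreover have "((\<lambda>\<alpha>. - (m \<alpha> (y - a) *\<^sub>R c \<alpha>)) has_sum - F y) J"
      using F[OF that(2)] unfolding m_def J_def by (simp only: has_sum_uminus minus_minus)
    ultimately show ?thesis
      using has_sum_add[OF has_sum_add[OF F[OF that(1), folded J_def]]]
      unfolding T_def m_def by (fastforce simp: scaleR_left_diff_distrib)
  qed
  define s where "s = r / (2 * DIM('a))"
  have "s > 0" using \<open>r > 0\<close> by (simp add: s_def)
  (* At p every monomial of degree k equals s ^ k, so convergence there bounds all coefficients. *)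
  define p where "p = a + s *\<^sub>R (\<Sum>b\<in>Basis. b)"
  have "norm (p - a) \<le> s * DIM('a)"
    unfolding p_def using \<open>s > 0\<close> norm_sum[of "\<lambda>b::'a. b" Basis] by (simp add: mult_left_mono)
  also have "\<dots> < r" using \<open>r > 0\<close> by (simp add: s_def)
  finally have "p \<in> ball a r" by (simp add: dist_norm norm_minus_commute)
  have mp: "m \<alpha> (p - a) = s ^ deg \<alpha>" for \<alpha>
    by (simp add: m_def p_def deg_def inner_sum_left inner_Basis power_sum
        if_distrib[of "\<lambda>x. _ * x"] sum.delta' cong: if_cong)
  have summ: "(\<lambda>\<alpha>. norm (s ^ deg \<alpha> *\<^sub>R c \<alpha>)) summable_on J"
    using F[OF \<open>p \<in> ball a r\<close>] mp unfolding m_def J_def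
    by (intro summable_on_imp_abs_summable_on) (auto simp: summable_on_def)
  define M where "M = infsum (\<lambda>\<alpha>. norm (s ^ deg \<alpha> *\<^sub>R c \<alpha>)) J"
  have "M \<ge> 0" unfolding M_def by (intro infsum_nonneg) auto
  (* For degree k the Lipschitz constant on the ball of radius \<rho> is k \<rho>^(k-1), and
     k \<rho>^(k-1) \<le> (2 \<rho> / s^2) s^k once \<rho> \<le> s / 2 and k \<ge> 2. *)
  have T_le: "norm (T \<alpha> x y) \<le> (2 * \<rho> / s\<^sup>2 * norm (x - y)) * norm (s ^ deg \<alpha> *\<^sub>R c \<alpha>)"
    if "0 < \<rho>" "\<rho> \<le> s / 2" "norm (x - a) \<le> \<rho>" "norm (y - a) \<le> \<rho>" for \<alpha> x y \<rho>
  proof -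
    have 0: "T \<alpha> x y = 0" if lt: "deg \<alpha> < 2"
    proof -
      consider "deg \<alpha> = 0" | "deg \<alpha> = 1" using lt by linarith
      then show ?thesis
      proof cases
        case 1
        then have "m \<alpha> v = 1" for v by (auto simp: m_def deg_def)
        then show ?thesis using 1 by (simp add: T_def)
      next
        case 2
        then show ?thesis
          by (simp add: T_def lin) (simp add: lin_def inner_diff_left sum_subtractf algebra_simps)
      qed
    qed
    show ?thesis
    proof (cases "deg \<alpha> < 2")
      case False
      define k where "k = deg \<alpha> - 2"
      have k: "deg \<alpha> = k + 2" using False by (simp add: k_def)
      have "\<bar>m \<alpha> (x - a) - m \<alpha> (y - a)\<bar> * \<rho> \<le> real (deg \<alpha>) * \<rho> ^ deg \<alpha> * norm (x - y)"
        unfolding m_def deg_def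
      proof (rule monomial_difference_bound)
        show "\<bar>(x - a) \<bullet> b - (y - a) \<bullet> b\<bar> \<le> norm (x - y)" if "b \<in> Basis" for b
          using Basis_le_norm[OF that, of "x - y"] by (simp add: inner_diff_left)
      qed (use that Basis_le_norm in \<open>blast intro: order_trans\<close>)+
      also have "\<dots> = (real (k + 2) * \<rho> ^ (k + 1) * norm (x - y)) * \<rho>"
        by (simp add: k)
      finally have "\<bar>m \<alpha> (x - a) - m \<alpha> (y - a)\<bar> \<le> real (k + 2) * \<rho> ^ (k + 1) * norm (x - y)"
        using \<open>\<rho> > 0\<close> by (rule mult_right_le_imp_le)
      also have "\<rho> ^ (k + 1) \<le> \<rho> * (s / 2) ^ k"
        using that by (simp add: power_mono)
      also have "real (k + 2) * (\<rho> * (s / 2) ^ k) = (real (k + 2) / 2 ^ k) * (\<rho> * s ^ k)"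
        by (simp add: power_divide)
      also have "real (k + 2) / 2 ^ k \<le> 2"
      proof -
        have "k + 2 \<le> 2 * 2 ^ k" by (induction k) auto
        then have "real (k + 2) \<le> real (2 * 2 ^ k)" by (rule of_nat_mono)
        then show ?thesis by (simp add: divide_simps)
      qed
      finally have "\<bar>m \<alpha> (x - a) - m \<alpha> (y - a)\<bar> \<le> 2 * (\<rho> * s ^ k) * norm (x - y)"
        using \<open>\<rho> > 0\<close> \<open>s > 0\<close> by (simp add: mult_left_mono mult_right_mono)
      also have "\<dots> = (2 * \<rho> / s\<^sup>2 * norm (x - y)) * s ^ deg \<alpha>"
        using \<open>s > 0\<close> by (simp add: k power_add power2_eq_square)
      finally have "\<bar>m \<alpha> (x - a) - m \<alpha> (y - a)\<bar> * norm (c \<alpha>)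
          \<le> (2 * \<rho> / s\<^sup>2 * norm (x - y)) * s ^ deg \<alpha> * norm (c \<alpha>)"
        by (rule mult_right_mono) auto
      then show ?thesis using k \<open>s > 0\<close> by (simp add: T_def mult.assoc)
    qed (use 0 that \<open>s > 0\<close> in simp)
  qed
  have est: "norm (F x - F y - L (x - y)) \<le> (2 * \<rho> / s\<^sup>2 * M) * norm (x - y)"
    if "0 < \<rho>" "\<rho> \<le> s / 2" "\<rho> < r" "norm (x - a) \<le> \<rho>" "norm (y - a) \<le> \<rho>" for x y \<rho>
  proof -
    have "((\<lambda>\<alpha>. (2 * \<rho> / s\<^sup>2 * norm (x - y)) * norm (s ^ deg \<alpha> *\<^sub>R c \<alpha>)) has_sum
        (2 * \<rho> / s\<^sup>2 * norm (x - y)) * M) J"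
      unfolding M_def by (intro has_sum_cmult_right has_sum_infsum summ)
    from norm_infsum_le[OF T this T_le] that show ?thesis
      by (simp add: dist_norm norm_minus_commute mult_ac)
  qed
  show ?thesis
    unfolding strict_derivative_at_def
  proof (intro exI[of _ L] conjI allI impI)
    fix e :: real assume "e > 0"
    define \<rho> where "\<rho> = min (min (s / 2) (r / 2)) (e * s\<^sup>2 / (2 * (M + 1)))"
    have "\<rho> \<le> s / 2" "\<rho> \<le> r / 2" unfolding \<rho>_def by linarith+
    moreover have "\<rho> > 0"
      using \<open>s > 0\<close> \<open>r > 0\<close> \<open>e > 0\<close> \<open>M \<ge> 0\<close> by (auto simp: \<rho>_def)
    ultimately have \<rho>: "\<rho> > 0" "\<rho> \<le> s / 2" "\<rho> < r" using \<open>r > 0\<close> by auto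
    have "\<rho> \<le> e * s\<^sup>2 / (2 * (M + 1))" by (simp add: \<rho>_def)
    then have "2 * \<rho> / s\<^sup>2 * (M + 1) \<le> e"
      using \<open>s > 0\<close> \<open>M \<ge> 0\<close> by (simp add: field_simps)
    moreover have "2 * \<rho> / s\<^sup>2 * M \<le> 2 * \<rho> / s\<^sup>2 * (M + 1)"
      using \<rho>(1) \<open>s > 0\<close> by (intro mult_left_mono) auto
    ultimately have "2 * \<rho> / s\<^sup>2 * M \<le> e" by linarith
    then have "norm (F x - F y - L (x - y)) \<le> e * norm (x - y)"
      if "norm (x - a) \<le> \<rho>" "norm (y - a) \<le> \<rho>" for x y
      using est[OF \<rho> that] mult_right_mono[OF _ norm_ge_zero, of _ e "x - y"] by (meson order_trans)
    then show "\<exists>d>0. \<forall>x\<in>ball a d. \<forall>y\<in>ball a d. norm (F x - F y - L (x - y)) \<le> e * norm (x - y)"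
      using \<rho>(1) by (intro exI[of _ \<rho>]) (auto simp: dist_norm norm_minus_commute less_imp_le)
  qed (fact \<open>bounded_linear L\<close>)
qed

text \<open>
  Near \<open>q\<close> both \<open>L\<close> and \<open>L'\<close> reproduce the increments of \<open>F\<close> up to \<open>e\<close>; linearity extends the
  comparison from short vectors to all vectors.
\<close>
lemma strict_derivative_close:
  assumes "e > 0" and L: "bounded_linear L"
    and d: "\<And>x y. norm (x - p) < d \<Longrightarrow> norm (y - p) < d \<Longrightarrow> norm (F x - F y - L (x - y)) \<le> e * norm (x - y)"
    and q: "norm (q - p) < d" "strict_derivative_at F L' q"
  shows "norm (L' v - L v) \<le> 2 * e * norm v"
proof -
  obtain d' where "d' > 0" and d':
    "\<And>x y. norm (x - q) < d' \<Longrightarrow> norm (y - q) < d' \<Longrightarrow> norm (F x - F y - L' (x - y)) \<le> e * norm (x - y)"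
    using strict_derivativeE[OF q(2) \<open>e > 0\<close>] by metis
  interpret L: bounded_linear L by fact
  interpret L': bounded_linear L' using q(2) by (simp add: strict_derivative_at_def)
  define N where "N = norm v + 1"
  have N: "N > 0" "norm v \<le> N" by (simp_all add: N_def add_nonneg_pos)
  define m where "m = min d' (d - norm (q - p))"
  have m: "m > 0" "m \<le> d'" "m \<le> d - norm (q - p)" using \<open>d' > 0\<close> q(1) by (auto simp: m_def)
  define h where "h = m / (2 * N)"
  have "h > 0" using m N by (simp add: h_def)
  have "h * norm v \<le> h * N" using \<open>h > 0\<close> N by (intro mult_left_mono) auto
  also have "\<dots> = m / 2" using N by (simp add: h_def)
  finally have hv: "norm (h *\<^sub>R v) < d'" "norm (h *\<^sub>R v) < d - norm (q - p)"
    using m \<open>h > 0\<close> by auto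
  have "norm (q + h *\<^sub>R v - p) < d"
    using norm_triangle_ineq[of "q - p" "h *\<^sub>R v"] hv(2) by (simp add: algebra_simps)
  then have 1: "norm (F (q + h *\<^sub>R v) - F q - L (h *\<^sub>R v)) \<le> e * norm (h *\<^sub>R v)"
    using d[of "q + h *\<^sub>R v" q] q(1) by simp
  have 2: "norm (F (q + h *\<^sub>R v) - F q - L' (h *\<^sub>R v)) \<le> e * norm (h *\<^sub>R v)"
    using d'[of "q + h *\<^sub>R v" q] hv(1) \<open>d' > 0\<close> by simp
  have "h *\<^sub>R (L' v - L v) = (F (q + h *\<^sub>R v) - F q - L (h *\<^sub>R v)) - (F (q + h *\<^sub>R v) - F q - L' (h *\<^sub>R v))"
    by (simp add: L.scaleR L'.scaleR scaleR_diff_right)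
  then have "norm (h *\<^sub>R (L' v - L v)) \<le> 2 * (e * norm (h *\<^sub>R v))"
    using 1 2 norm_triangle_ineq4[of "F (q + h *\<^sub>R v) - F q - L (h *\<^sub>R v)" "F (q + h *\<^sub>R v) - F q - L' (h *\<^sub>R v)"]
    by simp
  then have "h * norm (L' v - L v) \<le> h * (2 * e * norm v)"
    using \<open>h > 0\<close> by (simp add: mult_ac)
  then show ?thesis using \<open>h > 0\<close> by (rule mult_left_le_imp_le)
qed

lemma strict_derivative_continuous:
  assumes D: "\<And>p. strict_derivative_at F (D p) p"
  shows "continuous_on UNIV (\<lambda>p. D p v)"
  unfolding continuous_on_iff
proof (intro ballI allI impI)
  fix p and e :: real assume "e > 0"
  define N where "N = norm v + 1"
  have N: "N > 0" "norm v \<le> N" by (simp_all add: N_def add_nonneg_pos)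
  define e1 where "e1 = e / (4 * N)"
  have "e1 > 0" using \<open>e > 0\<close> N by (simp add: e1_def)
  obtain d where "d > 0" and d:
    "\<And>x y. norm (x - p) < d \<Longrightarrow> norm (y - p) < d \<Longrightarrow> norm (F x - F y - D p (x - y)) \<le> e1 * norm (x - y)"
    using strict_derivativeE[OF D \<open>e1 > 0\<close>] by metis
  have lin: "bounded_linear (D p)" using D by (simp add: strict_derivative_at_def)
  have "dist (D q v) (D p v) < e" if "dist q p < d" for q
  proof -
    have "norm (D q v - D p v) \<le> 2 * e1 * norm v"
      by (rule strict_derivative_close[OF \<open>e1 > 0\<close> lin d _ D]) (use that in \<open>auto simp: dist_norm\<close>)
    also have "\<dots> \<le> 2 * e1 * N" using \<open>e1 > 0\<close> N by (intro mult_left_mono) auto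
    also have "\<dots> = e / 2" using N by (simp add: e1_def)
    also have "\<dots> < e" using \<open>e > 0\<close> by simp
    finally show ?thesis by (simp add: dist_norm)
  qed
  then show "\<exists>d>0. \<forall>q\<in>UNIV. dist q p < d \<longrightarrow> dist (D q v) (D p v) < e" using \<open>d > 0\<close> by blast
qed

text \<open>
  A finite subcover of \<open>S\<close> by balls on which \<open>F - D p\<close> has Lipschitz constant \<open>e / 3\<close>; replacing
  \<open>D p\<close> by \<open>D a\<close> for a nearby \<open>a\<close> costs \<open>2 e / 3\<close>.
\<close>
lemma strict_derivative_uniform:
  assumes D: "\<And>p. strict_derivative_at F (D p) p" and "compact S" "e > 0"
  shows "\<exists>d>0. \<forall>a\<in>S. \<forall>x y. norm (x - a) < d \<longrightarrow> norm (y - a) < d \<longrightarrow>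
    norm (F x - F y - D a (x - y)) \<le> e * norm (x - y)"
proof -
  have e3: "e / 3 > 0" using \<open>e > 0\<close> by simp
  have "\<forall>p. \<exists>d>0. \<forall>x y. norm (x - p) < d \<longrightarrow> norm (y - p) < d \<longrightarrow>
    norm (F x - F y - D p (x - y)) \<le> e / 3 * norm (x - y)"
    using strict_derivativeE[OF D e3] by metis
  then obtain r where "\<forall>p. r p > 0 \<and> (\<forall>x y. norm (x - p) < r p \<longrightarrow> norm (y - p) < r p \<longrightarrow>
    norm (F x - F y - D p (x - y)) \<le> e / 3 * norm (x - y))"
    unfolding choice_iff by blast
  then have r0: "\<And>p. r p > 0" and r: "\<And>p x y. norm (x - p) < r p \<Longrightarrow> norm (y - p) < r p \<Longrightarrow>
    norm (F x - F y - D p (x - y)) \<le> e / 3 * norm (x - y)" by blast+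
  obtain P where "P \<subseteq> S" "finite P" and P: "S \<subseteq> (\<Union>p\<in>P. ball p (r p / 2))"
    using compactE_image[OF \<open>compact S\<close>, of S "\<lambda>p. ball p (r p / 2)"] r0 by force
  define d where "d = Min (insert 1 ((\<lambda>p. r p / 2) ` P))"
  have "d > 0" unfolding d_def using \<open>finite P\<close> r0 by (subst Min_gr_iff) auto
  have d_le: "d \<le> r p / 2" if "p \<in> P" for p
    unfolding d_def using \<open>finite P\<close> that by (intro Min_le) auto
  have "norm (F x - F y - D a (x - y)) \<le> e * norm (x - y)"
    if "a \<in> S" and xy: "norm (x - a) < d" "norm (y - a) < d" for a x y
  proof -
    obtain p where "p \<in> P" and a: "norm (a - p) < r p / 2"
      using P \<open>a \<in> S\<close> by (auto simp: dist_norm norm_minus_commute)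
    have near: "norm (w - p) < r p" if "norm (w - a) < d" for w
      using norm_triangle_ineq[of "w - a" "a - p"] that a d_le[OF \<open>p \<in> P\<close>] by simp
    have "norm (F x - F y - D p (x - y)) \<le> e / 3 * norm (x - y)"
      using r near xy by blast
    moreover have "norm (D a (x - y) - D p (x - y)) \<le> 2 * (e / 3) * norm (x - y)"
    proof (rule strict_derivative_close[OF e3 _ r])
      show "bounded_linear (D p)" using D by (simp add: strict_derivative_at_def)
      show "norm (a - p) < r p" using a r0[of p] by simp
      show "strict_derivative_at F (D a) a" by (rule D)
    qed
    moreover have "norm (F x - F y - D a (x - y)) \<le> norm (F x - F y - D p (x - y)) + norm (D a (x - y) - D p (x - y))"
      using norm_triangle_ineq4[of "F x - F y - D p (x - y)" "D a (x - y) - D p (x - y)"] by simp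
    ultimately have "norm (F x - F y - D a (x - y)) \<le> e / 3 * norm (x - y) + 2 * (e / 3) * norm (x - y)"
      by linarith
    then show ?thesis by (simp add: field_simps)
  qed
  then show ?thesis using \<open>d > 0\<close> by blast
qed

section \<open>A product of linear factors annihilating a hyperbolic matrix\<close>

fun linear_factors :: "complex ^ 'm ^ 'm \<Rightarrow> complex list \<Rightarrow> complex ^ 'm \<Rightarrow> complex ^ 'm" where
  "linear_factors A [] v = v"
| "linear_factors A (l # ls) v = A *v linear_factors A ls v - l *s linear_factors A ls v"

lemma matrix_vector_mult_smult: "A *v (c *s v) = c *s (A *v v)" for A :: "'a::comm_semiring_1 ^ 'n ^ 'm"
  by (simp add: vec_eq_iff matrix_vector_mult_def sum_distrib_left mult_ac)

lemma linear_factors_add: "linear_factors A ls (v + w) = linear_factors A ls v + linear_factors A ls w"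
  by (induction ls) (auto simp: matrix_vector_right_distrib vector_add_ldistrib)

lemma linear_factors_smult: "linear_factors A ls (c *s v) = c *s linear_factors A ls v"
  by (induction ls) (auto simp: matrix_vector_mult_smult vector_sub_rdistrib vector_ssub_ldistrib vector_smult_assoc mult.commute)

lemma linear_factors_matrix: "linear_factors A ls (A *v v) = A *v linear_factors A ls v"
  by (induction ls) (auto simp: matrix_vector_mult_smult matrix_vector_mult_diff_distrib)

lemma linear_factors_diff: "linear_factors A ls (v - w) = linear_factors A ls v - linear_factors A ls w"
  using linear_factors_add[of A ls v "(-1) *s w"] linear_factors_smult[of A ls "-1" w]
  by (simp add: vector_smult_lneg)

text \<open>
  The factors commute, so the head of the list may also act first.
\<close>
lemma linear_factors_shift:
  "linear_factors A (l # ls) v = linear_factors A ls (A *v v - l *s v)"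
  by (simp add: linear_factors_diff linear_factors_smult linear_factors_matrix)

text \<open>
  A factor with trivial kernel can be cancelled from an annihilating product.
\<close>
lemma linear_factors_filter:
  assumes "\<And>l v. \<not> P l \<Longrightarrow> A *v v - l *s v = 0 \<Longrightarrow> v = 0"
  shows "linear_factors A ls v = 0 \<Longrightarrow> linear_factors A (filter P ls) v = 0"
proof (induction ls arbitrary: v)
  case (Cons l ls)
  show ?case
  proof (cases "P l")
    case True
    then show ?thesis using Cons by (simp add: linear_factors_shift del: linear_factors.simps)
  next
    case False
    then show ?thesis using Cons assms[OF False] by simp
  qed
qed simp

definition poly_act :: "complex poly \<Rightarrow> complex ^ 'm ^ 'm \<Rightarrow> complex ^ 'm \<Rightarrow> complex ^ 'm" where
  "poly_act p A v = (\<Sum>i\<le>degree p. coeff p i *s (((*v) A) ^^ i) v)"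

lemma poly_act_altdef:
  assumes "degree p \<le> N"
  shows "poly_act p A v = (\<Sum>i\<le>N. coeff p i *s (((*v) A) ^^ i) v)"
  unfolding poly_act_def using assms
  by (intro sum.mono_neutral_left) (auto simp: coeff_eq_0 vector_smult_lzero)

lemma poly_act_linear_factor:
  "poly_act ([:-l, 1:] * p) A v = A *v poly_act p A v - l *s poly_act p A v"
proof -
  let ?A = "\<lambda>i. (((*v) A) ^^ i) v" and ?N = "Suc (degree p)"
  have "degree ([:-l, 1:] * p) \<le> ?N" using degree_mult_le[of "[:-l, 1:]" p] by simp
  then have "poly_act ([:-l, 1:] * p) A v = (\<Sum>i\<le>?N. coeff ([:-l, 1:] * p) i *s ?A i)"
    by (rule poly_act_altdef)
  also have "\<dots> = (\<Sum>i\<le>?N. coeff (pCons 0 p) i *s ?A i) - l *s (\<Sum>i\<le>?N. coeff p i *s ?A i)"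
    by (simp add: vector_sub_rdistrib sum_subtractf vec_eq_iff sum_distrib_left algebra_simps
        del: sum.atMost_Suc)
  also have "(\<Sum>i\<le>?N. coeff (pCons 0 p) i *s ?A i) = (\<Sum>i\<le>degree p. coeff p i *s (A *v ?A i))"
    by (subst sum.atMost_Suc_shift) (simp add: vector_smult_lzero)
  also have "\<dots> = A *v poly_act p A v"
    unfolding poly_act_def by (simp add: linear_sum[OF matrix_vector_mul_linear] flip: matrix_vector_mult_smult)
  also have "(\<Sum>i\<le>?N. coeff p i *s ?A i) = poly_act p A v"
    by (rule poly_act_altdef[symmetric]) simp
  finally show ?thesis .
qed

lemma poly_act_roots:
  "poly_act (smult c (\<Prod>l\<leftarrow>ls. [:-l, 1:])) A v = c *s linear_factors A ls v"
proof (induction ls)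
  case Nil
  then show ?case by (simp add: poly_act_def)
next
  case (Cons l ls)
  have "smult c (\<Prod>l\<leftarrow>l # ls. [:-l, 1:]) = [:-l, 1:] * smult c (\<Prod>l\<leftarrow>ls. [:-l, 1:])"
    by (simp only: list.map prod_list.Cons mult_smult_right)
  then show ?case
    by (simp only: poly_act_linear_factor Cons)
       (simp add: matrix_vector_mult_smult vector_ssub_ldistrib vector_smult_assoc mult.commute)
qed

lemma nontrivial_relation:
  fixes w :: "nat \<Rightarrow> 'a::euclidean_space"
  shows "\<exists>c. (\<exists>i\<le>DIM('a). c i \<noteq> 0) \<and> (\<Sum>i\<le>DIM('a). c i *\<^sub>R w i) = 0"
proof (cases "inj_on w {..DIM('a)}")
  case True
  then have "card (w ` {..DIM('a)}) > DIM('a)" by (simp add: card_image)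
  then have "dependent (w ` {..DIM('a)})" using independent_bound by fastforce
  then obtain u where u: "\<exists>v\<in>w ` {..DIM('a)}. u v \<noteq> 0" "(\<Sum>v\<in>w ` {..DIM('a)}. u v *\<^sub>R v) = 0"
    by (subst (asm) dependent_finite) auto
  have "(\<Sum>i\<le>DIM('a). (u \<circ> w) i *\<^sub>R w i) = 0"
    using u(2) True by (simp add: sum.reindex)
  then show ?thesis using u(1) by (intro exI[of _ "u \<circ> w"]) auto
next
  case False
  then obtain i j where ij: "i \<le> DIM('a)" "j \<le> DIM('a)" "i \<noteq> j" "w i = w j"
    by (auto simp: inj_on_def)
  have "(\<Sum>k\<le>DIM('a). ((if k = i then 1 else 0) - (if k = j then 1 else 0)) *\<^sub>R w k)
      = (\<Sum>k\<le>DIM('a). if k = i then w k else 0) - (\<Sum>k\<le>DIM('a). if k = j then w k else 0)"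
    by (subst sum_subtractf[symmetric], rule sum.cong) auto
  also have "\<dots> = 0" using ij by simp
  finally show ?thesis using ij
    by (intro exI[of _ "\<lambda>k. (if k = i then 1 else 0) - (if k = j then 1 else 0)"]) (auto intro!: exI[of _ i])
qed

text \<open>
  The powers of \<open>A\<close> live in a finite-dimensional space, so some nonzero polynomial kills \<open>A\<close>; it
  splits over the complex numbers.
\<close>
lemma annihilating_linear_factors:
  fixes A :: "complex ^ 'm ^ 'm"
  shows "\<exists>ls. \<forall>v. linear_factors A ls v = 0"
proof -
  let ?N = "DIM(complex ^ 'm ^ 'm)"
  define M where "M = (\<lambda>i. ((\<lambda>X. A ** X) ^^ i) (mat 1))"
  have M: "M i *v v = (((*v) A) ^^ i) v" for i v
    by (induction i) (simp_all add: M_def flip: matrix_vector_mul_assoc)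
  obtain c where c: "\<exists>i\<le>?N. c i \<noteq> 0" "(\<Sum>i\<le>?N. c i *\<^sub>R M i) = 0"
    using nontrivial_relation[of M] by auto
  define p where "p = (\<Sum>i\<le>?N. monom (complex_of_real (c i)) i)"
  have coeff: "coeff p i = (if i \<le> ?N then complex_of_real (c i) else 0)" for i
    unfolding p_def by (simp add: coeff_sum)
  have "p \<noteq> 0" using c(1) coeff by (metis coeff_0 of_real_eq_0_iff)
  have "degree p \<le> ?N" by (intro degree_le) (simp add: coeff)
  have act: "poly_act p A v = 0" for v
  proof -
    have "poly_act p A v = (\<Sum>i\<le>?N. complex_of_real (c i) *s (M i *v v))"
      unfolding poly_act_altdef[OF \<open>degree p \<le> ?N\<close>] M by (rule sum.cong) (auto simp: coeff)
    also have "\<dots> = (\<Sum>i\<le>?N. c i *\<^sub>R M i) *v v"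
      by (simp add: vec_eq_iff matrix_vector_mult_def sum_component sum_distrib_left sum_distrib_right
          scaleR_conv_of_real[where 'a = complex] mult.assoc) (intro allI, subst sum.swap, rule refl)
    also have "\<dots> = 0" unfolding c(2) by simp
    finally show ?thesis .
  qed
  obtain roots where "mset roots = proots p" using ex_mset by blast
  then have "p = smult (lead_coeff p) (\<Prod>l\<leftarrow>roots. [:-l, 1:])"
    using complex_poly_decompose_multiset[of p] by (metis mset_map prod_mset_prod_list)
  then have "lead_coeff p *s linear_factors A roots v = 0" for v
    using act poly_act_roots by metis
  then show ?thesis using \<open>p \<noteq> 0\<close> by (metis leading_coeff_0_iff vector_mul_eq_0)
qed

lemma poly_char_polynomial:
  fixes A :: "real ^ 'm ^ 'm"
  shows "poly (char_polynomial A) z = det (mat z - map_matrix complex_of_real A)"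
  unfolding char_polynomial_def det_def
  by (auto simp: poly_sum poly_prod mat_def map_matrix_def intro!: sum.cong prod.cong)

text \<open>
  If \<open>l\<close> is purely imaginary then it is not an eigenvalue and \<open>A - l\<close> is injective, so such factors
  can be dropped from any annihilating product. Nonemptiness of the multiset of eigenvalues
  guarantees that the characteristic polynomial is nonzero: the zero polynomial has the empty
  multiset of roots by convention.
\<close>
lemma hyperbolic_annihilator:
  fixes A :: "real ^ 'm ^ 'm"
  assumes "eigenvalues A \<noteq> {#}" "\<And>l. l \<in># eigenvalues A \<Longrightarrow> Re l \<noteq> 0"
  shows "\<exists>ls. (\<forall>l\<in>set ls. Re l \<noteq> 0) \<and> (\<forall>v. linear_factors (map_matrix complex_of_real A) ls v = 0)"
proof -
  let ?A = "map_matrix complex_of_real A"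
  have "char_polynomial A \<noteq> 0" using assms(1) by (auto simp: eigenvalues_def)
  then have ev: "det (mat l - ?A) \<noteq> 0" if "Re l = 0" for l
    using assms(2)[of l] that by (auto simp: eigenvalues_def poly_char_polynomial)
  have inj: "v = 0" if "\<not> Re l \<noteq> 0" "?A *v v - l *s v = 0" for l v
  proof -
    have "(mat l - ?A) *v v = l *s v - ?A *v v"
      by (simp add: vec_eq_iff matrix_vector_mult_def mat_def left_diff_distrib sum_subtractf
          if_distrib[of "\<lambda>x. x * _"] cong: if_cong)
    then have "(mat l - ?A) *v v = 0" using that(2) by simp
    then show ?thesis
      using ev[of l] that(1) by (metis invertible_det_nz invertible_left_inverse matrix_left_invertible_ker)
  qed
  obtain ls where "\<And>v. linear_factors ?A ls v = 0" using annihilating_linear_factors by blast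
  then have "linear_factors ?A (filter (\<lambda>l. Re l \<noteq> 0) ls) v = 0" for v
    using linear_factors_filter[of "\<lambda>l. Re l \<noteq> 0" ?A ls v] inj by blast
  then show ?thesis by (intro exI[of _ "filter (\<lambda>l. Re l \<noteq> 0) ls"]) auto
qed

section \<open>Bounded solutions of the scalar equation on the line\<close>

text \<open>
  Convolution with a kernel that decays faster than \<open>exp (- \<eta> \<bar>t\<bar>)\<close> maps functions dominated by
  such an \<open>\<omega>\<close> to functions dominated by a multiple of the same \<open>\<omega>\<close>.
\<close>
definition slowly_varying :: "real \<Rightarrow> (real \<Rightarrow> real) \<Rightarrow> bool" where
  "slowly_varying \<eta> \<omega> \<longleftrightarrow> (\<forall>s t. \<omega> s \<le> exp (\<eta> * \<bar>s - t\<bar>) * \<omega> t)"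

lemma slowly_varying_const: "0 \<le> \<eta> \<Longrightarrow> 0 \<le> M \<Longrightarrow> slowly_varying \<eta> (\<lambda>_. M)"
  unfolding slowly_varying_def
  by (metis abs_ge_zero mult_nonneg_nonneg mult_right_mono mult_1 one_le_exp_iff)

lemma slowly_varying_scaled: "0 \<le> c \<Longrightarrow> slowly_varying \<eta> \<omega> \<Longrightarrow> slowly_varying \<eta> (\<lambda>t. c * \<omega> t)"
  unfolding slowly_varying_def by (simp add: mult_left_mono mult.left_commute[of _ c])

text \<open>
  These weights express smallness near infinity: with \<open>\<epsilon>\<close> arbitrary and \<open>C\<close> depending on \<open>\<epsilon>\<close>,
  domination by them means that the function tends to \<open>0\<close>.
\<close>
lemma slowly_varying_exp:
  assumes "0 \<le> \<eta>" "0 \<le> \<epsilon>" "0 \<le> C"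
  shows "slowly_varying \<eta> (\<lambda>t. \<epsilon> + C * exp (- \<eta> * \<bar>t\<bar>))"
  unfolding slowly_varying_def
proof (intro allI)
  fix s t :: real
  have "- \<eta> * \<bar>s\<bar> \<le> \<eta> * \<bar>s - t\<bar> + - \<eta> * \<bar>t\<bar>"
    using mult_left_mono[of "\<bar>t\<bar>" "\<bar>s\<bar> + \<bar>s - t\<bar>" \<eta>] assms(1) by (simp add: algebra_simps)
  then have "exp (- \<eta> * \<bar>s\<bar>) \<le> exp (\<eta> * \<bar>s - t\<bar>) * exp (- \<eta> * \<bar>t\<bar>)"
    by (simp flip: exp_add)
  then have "C * exp (- \<eta> * \<bar>s\<bar>) \<le> C * (exp (\<eta> * \<bar>s - t\<bar>) * exp (- \<eta> * \<bar>t\<bar>))"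
    using assms(3) by (rule mult_left_mono)
  moreover have "\<epsilon> \<le> exp (\<eta> * \<bar>s - t\<bar>) * \<epsilon>"
    using mult_right_mono[of 1 "exp (\<eta> * \<bar>s - t\<bar>)" \<epsilon>] assms by simp
  ultimately show "\<epsilon> + C * exp (- \<eta> * \<bar>s\<bar>) \<le> exp (\<eta> * \<bar>s - t\<bar>) * (\<epsilon> + C * exp (- \<eta> * \<bar>t\<bar>))"
    by (simp add: algebra_simps)
qed

lemma slowly_varying_reflect: "slowly_varying \<eta> \<omega> \<Longrightarrow> slowly_varying \<eta> (\<lambda>t. \<omega> (- t))"
  unfolding slowly_varying_def
proof (intro allI)
  fix s t assume "\<forall>s t. \<omega> s \<le> exp (\<eta> * \<bar>s - t\<bar>) * \<omega> t"
  then have "\<omega> (- s) \<le> exp (\<eta> * \<bar>- s - - t\<bar>) * \<omega> (- t)" by blast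
  then show "\<omega> (- s) \<le> exp (\<eta> * \<bar>s - t\<bar>) * \<omega> (- t)" by (simp add: abs_minus_commute)
qed

lemma has_vector_derivative_exp_of_real_mult:
  "((\<lambda>t. exp (of_real t * l)) has_vector_derivative exp (of_real t * l) * l) (at t)" for l :: complex
  by (rule has_vector_derivative_real_field) (auto intro!: derivative_eq_intros)

text \<open>
  For \<open>Re l > 0\<close> every other solution grows at \<open>+\<infinity>\<close>, and the bounded one is
  \<open>y(t) = - \<integral>\<^bsub>t\<^esub>\<^bsup>\<infinity>\<^esup> exp (l (t - s)) k(s) ds\<close>. The bound follows from
  \<open>\<omega>(s) \<le> exp (\<eta> (s - t)) \<omega>(t)\<close> under the integral.
\<close>
lemma scalar_bounded_solution_unstable:
  fixes k :: "real \<Rightarrow> complex"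
  assumes \<eta>: "0 \<le> \<eta>" "\<eta> < Re l" and k: "continuous_on UNIV k" "\<And>t. norm (k t) \<le> M"
  shows "\<exists>y. (\<forall>t. (y has_vector_derivative l * y t + k t) (at t)) \<and>
    (\<forall>\<omega>. slowly_varying \<eta> \<omega> \<longrightarrow> (\<forall>s. norm (k s) \<le> \<omega> s) \<longrightarrow> (\<forall>t. norm (y t) \<le> \<omega> t / (Re l - \<eta>)))"
proof -
  define h where "h = (\<lambda>s. exp (- (of_real s * l)) * k s)"
  have h: "continuous_on S h" for S
    unfolding h_def by (intro continuous_intros continuous_on_subset[OF k(1)]) auto
  have norm_h: "norm (h s) = exp (- Re l * s) * norm (k s)" for s
    by (simp add: h_def norm_mult norm_exp mult.commute)
  have Re: "Re l > 0" using \<eta> by linarith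
  have int: "h integrable_on {t..}" for t
  proof (rule measurable_bounded_by_integrable_imp_integrable)
    show "h \<in> borel_measurable (lebesgue_on {t..})"
      by (rule continuous_imp_measurable_on_sets_lebesgue[OF h]) auto
    show "(\<lambda>s. M * exp (- Re l * s)) integrable_on {t..}"
      using integrable_on_exp_minus_to_infinity[OF Re] by (rule integrable_on_mult_right)
    show "norm (h s) \<le> M * exp (- Re l * s)" for s
      using k(2)[of s] unfolding norm_h by (simp add: mult.commute)
  qed auto
  define I where "I = (\<lambda>t. integral {t..} h)"
  have I: "(I has_vector_derivative - h t) (at t)" for t
  proof -
    let ?c = "t - 1"
    (* Near t the tail integral is a constant minus an integral over a compact interval. *)
    have split: "I ?c - integral {?c..u} h = I u" if "u \<in> {?c..t + 1}" for u
    proof -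
      have "{?c..u} \<union> {u..} = {?c..}" "{?c..u} \<inter> {u..} = {u}" using that by auto
      moreover have "h integrable_on {?c..u}"
        by (rule integrable_continuous_interval[OF h])
      ultimately show ?thesis
        using integral_Un[of h "{?c..u}" "{u..}"] int by (simp add: I_def)
    qed
    have "((\<lambda>u. integral {?c..u} h) has_vector_derivative h t) (at t within {?c..t + 1})"
      by (rule integral_has_vector_derivative[OF h]) auto
    then have "((\<lambda>u. I ?c - integral {?c..u} h) has_vector_derivative 0 - h t) (at t within {?c..t + 1})"
      by (intro has_vector_derivative_diff has_vector_derivative_const)
    then have "(I has_vector_derivative 0 - h t) (at t within {?c..t + 1})"
      by (rule has_vector_derivative_transform[rotated 2]) (use split in auto)
    then show ?thesis
      by (subst (asm) at_within_interior) auto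
  qed
  define y where "y = (\<lambda>t. - exp (of_real t * l) * I t)"
  have "(y has_vector_derivative l * y t + k t) (at t)" for t
  proof -
    have "((\<lambda>t. exp (of_real t * l) * I t) has_vector_derivative
        exp (of_real t * l) * - h t + exp (of_real t * l) * l * I t) (at t)"
      by (intro has_vector_derivative_mult I has_vector_derivative_exp_of_real_mult)
    then have "((\<lambda>t. - (exp (of_real t * l) * I t)) has_vector_derivative
        - (exp (of_real t * l) * - h t + exp (of_real t * l) * l * I t)) (at t)"
      by (rule has_vector_derivative_minus)
    moreover have "exp (of_real t * l) * h t = k t"
      by (simp add: h_def flip: mult.assoc exp_add)
    ultimately show ?thesis by (simp add: y_def algebra_simps)
  qed
  moreover have "norm (y t) \<le> \<omega> t / (Re l - \<eta>)"
    if \<omega>: "slowly_varying \<eta> \<omega>" "\<And>s. norm (k s) \<le> \<omega> s" for \<omega> t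
  proof -
    let ?a = "Re l - \<eta>"
    define g where "g = (\<lambda>s. \<omega> t * exp (- \<eta> * t) * exp (- ?a * s))"
    have "?a > 0" using \<eta> by simp
    from has_integral_mult_right[OF has_integral_exp_minus_to_infinity[OF this]]
    have g: "(g has_integral (\<omega> t * exp (- \<eta> * t)) * (exp (- ?a * t) / ?a)) {t..}"
      unfolding g_def .
    have "norm (h s) \<le> g s" if "s \<in> {t..}" for s
    proof -
      have "norm (k s) \<le> exp (\<eta> * \<bar>s - t\<bar>) * \<omega> t"
        using \<omega>(1)[unfolded slowly_varying_def, rule_format, of s t] \<omega>(2)[of s] by linarith
      then have "norm (h s) \<le> exp (- Re l * s) * (exp (\<eta> * \<bar>s - t\<bar>) * \<omega> t)"
        unfolding norm_h by (intro mult_left_mono) auto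
      also have "\<dots> = g s"
        using that unfolding g_def by (simp add: algebra_simps flip: exp_add)
      finally show ?thesis .
    qed
    then have "norm (I t) \<le> (\<omega> t * exp (- \<eta> * t)) * (exp (- ?a * t) / ?a)"
      using integral_norm_bound_integral[OF int has_integral_integrable[OF g]] integral_unique[OF g]
      by (simp add: I_def)
    then have "exp (Re l * t) * norm (I t) \<le> exp (Re l * t) * ((\<omega> t * exp (- \<eta> * t)) * (exp (- ?a * t) / ?a))"
      by (intro mult_left_mono) auto
    then have "norm (y t) \<le> exp (Re l * t) * ((\<omega> t * exp (- \<eta> * t)) * (exp (- ?a * t) / ?a))"
      unfolding y_def by (simp add: norm_mult norm_exp mult.commute)
    also have "\<dots> = \<omega> t / ?a * (exp (Re l * t) * exp (- \<eta> * t) * exp (- ?a * t))"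
      by simp
    also have "exp (Re l * t) * exp (- \<eta> * t) * exp (- ?a * t) = 1"
      by (simp add: algebra_simps flip: exp_add)
    finally show ?thesis by simp
  qed
  ultimately show ?thesis by (intro exI[of _ y]) blast
qed

lemma has_vector_derivative_reflect:
  fixes y :: "real \<Rightarrow> 'a::real_normed_vector"
  assumes "(y has_vector_derivative d) (at (- t))"
  shows "((\<lambda>t. y (- t)) has_vector_derivative - d) (at t)"
proof -
  have "((\<lambda>t::real. - t) has_vector_derivative - 1) (at t)"
    by (auto intro!: derivative_eq_intros)
  from vector_diff_chain_at[OF this assms] show ?thesis by (simp add: o_def)
qed

text \<open>
  Reversing time exchanges \<open>l\<close> and \<open>- l\<close>, so the case \<open>Re l > 0\<close> suffices.
\<close>
lemma scalar_bounded_solution: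
  fixes k :: "real \<Rightarrow> complex"
  assumes \<eta>: "0 \<le> \<eta>" "\<eta> < \<bar>Re l\<bar>" and k: "continuous_on UNIV k" "\<And>t. norm (k t) \<le> M"
  shows "\<exists>y. (\<forall>t. (y has_vector_derivative l * y t + k t) (at t)) \<and>
    (\<forall>\<omega>. slowly_varying \<eta> \<omega> \<longrightarrow> (\<forall>s. norm (k s) \<le> \<omega> s) \<longrightarrow> (\<forall>t. norm (y t) \<le> \<omega> t / (\<bar>Re l\<bar> - \<eta>)))"
proof (cases "Re l > 0")
  case True
  then show ?thesis using scalar_bounded_solution_unstable[of \<eta> l k M] assms by simp
next
  case False
  have "continuous_on UNIV (\<lambda>t. k (- t))"
    by (intro continuous_on_compose2[OF k(1)] continuous_intros) auto
  then have "\<exists>u. (\<forall>t. (u has_vector_derivative - l * u t + k (- t)) (at t)) \<and>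
    (\<forall>\<omega>. slowly_varying \<eta> \<omega> \<longrightarrow> (\<forall>s. norm (k (- s)) \<le> \<omega> s) \<longrightarrow> (\<forall>t. norm (u t) \<le> \<omega> t / (Re (- l) - \<eta>)))"
    using False assms by (intro scalar_bounded_solution_unstable) auto
  then obtain u where u: "\<And>t. (u has_vector_derivative - l * u t + k (- t)) (at t)"
    and bound: "\<And>\<omega> t. slowly_varying \<eta> \<omega> \<Longrightarrow> (\<And>s. norm (k (- s)) \<le> \<omega> s) \<Longrightarrow> norm (u t) \<le> \<omega> t / (\<bar>Re l\<bar> - \<eta>)"
    using False by fastforce
  show ?thesis
  proof (intro exI[of _ "\<lambda>t. - u (- t)"] conjI allI impI)
    fix t
    show "((\<lambda>t. - u (- t)) has_vector_derivative l * - u (- t) + k t) (at t)"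
      using has_vector_derivative_minus[OF has_vector_derivative_reflect[OF u[of "- t"]]] by simp
    fix \<omega> assume "slowly_varying \<eta> \<omega>" "\<forall>s. norm (k s) \<le> \<omega> s"
    then show "norm (- u (- t)) \<le> \<omega> t / (\<bar>Re l\<bar> - \<eta>)"
      using bound[OF slowly_varying_reflect, of \<omega> "- t"] by simp
  qed
qed

lemma exponential_bounded_imp_zero:
  fixes u :: "real \<Rightarrow> complex"
  assumes "Re l \<noteq> 0" and u: "\<And>t. (u has_vector_derivative l * u t) (at t)" and M: "\<And>t. norm (u t) \<le> M"
  shows "u t = 0"
proof -
  define q where "q = (\<lambda>t. exp (of_real t * - l) * u t)"
  have "(q has_vector_derivative 0) (at t)" for t
  proof -
    from has_vector_derivative_mult[OF has_vector_derivative_exp_of_real_mult[of "- l"] u[of t]] show ?thesis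
      by (simp add: q_def algebra_simps)
  qed
  then obtain c where c: "\<And>t. q t = c"
    using has_vector_derivative_zero_constant[of UNIV q] by auto
  have c_le: "norm c \<le> exp (- (Re l * t)) * M" for t
    using c[of t] M[of t] by (auto simp: q_def norm_mult norm_exp mult.commute)
  have "c = 0"
  proof (rule ccontr)
    assume "c \<noteq> 0"
    (* The sign of Re l is built into t, so that |c| \<le> exp (-(M / |c|)) M, against exp x > x. *)
    define t where "t = M / norm c / Re l"
    have "norm c \<le> exp (- (M / norm c)) * M"
      using c_le[of t] \<open>Re l \<noteq> 0\<close> by (simp add: t_def)
    moreover have "M / norm c < exp (M / norm c)"
      using exp_ge_add_one_self[of "M / norm c"] by linarith
    ultimately show False
      using \<open>c \<noteq> 0\<close> by (simp add: exp_minus field_simps)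
  qed
  then have "exp (of_real t * - l) * u t = 0" using c[of t] by (simp add: q_def)
  then show ?thesis by simp
qed

section \<open>Bounded solutions of hyperbolic systems with constant coefficients\<close>

lemma scaleR_eq_smult: "c *\<^sub>R v = complex_of_real c *s v" for v :: "complex ^ 'm"
  by (simp add: vec_eq_iff scaleR_conv_of_real[where 'a = complex])

lemma linear_smult: "linear ((*s) l)" for l :: complex
  by (intro linearI) (auto simp: vector_add_ldistrib scaleR_eq_smult vector_smult_assoc mult.commute)

lemma linear_linear_factors: "linear (linear_factors A ls)"
  by (intro linearI) (simp_all add: linear_factors_add linear_factors_smult scaleR_eq_smult)

lemma has_vector_derivative_linear:
  fixes f :: "'a::euclidean_space \<Rightarrow> 'b::real_normed_vector"
  assumes "linear f" "(y has_vector_derivative d) F"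
  shows "((\<lambda>t. f (y t)) has_vector_derivative f d) F"
  using bounded_linear.has_vector_derivative[OF _ assms(2)] assms(1) linear_conv_bounded_linear by blast

lemma has_vector_derivative_vecI:
  fixes y :: "real \<Rightarrow> 'b::real_normed_vector ^ 'm"
  assumes "\<And>i. ((\<lambda>t. y t $ i) has_vector_derivative d $ i) (at t)"
  shows "(y has_vector_derivative d) (at t)"
  unfolding has_vector_derivative_def has_derivative_def
  using assms[unfolded has_vector_derivative_def has_derivative_def]
  by (auto intro!: vec_tendstoI bounded_linear_scaleR_left)

lemma differentiable_continuous_on:
  assumes "\<And>t. (y has_vector_derivative d t) (at t)"
  shows "continuous_on UNIV y"
  using assms by (auto simp: continuous_on_eq_continuous_within intro: has_vector_derivative_continuous)

lemma vector_bounded_solution: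
  fixes k :: "real \<Rightarrow> complex ^ 'm"
  assumes \<eta>: "0 \<le> \<eta>" "\<eta> < \<bar>Re l\<bar>" and k: "continuous_on UNIV k" "\<And>t. norm (k t) \<le> M"
  shows "\<exists>y. (\<forall>t. (y has_vector_derivative l *s y t + k t) (at t)) \<and>
    (\<forall>\<omega>. slowly_varying \<eta> \<omega> \<longrightarrow> (\<forall>s. norm (k s) \<le> \<omega> s) \<longrightarrow>
      (\<forall>t. norm (y t) \<le> (CARD('m) / (\<bar>Re l\<bar> - \<eta>)) * \<omega> t))"
proof -
  have "\<forall>i. \<exists>y. (\<forall>t. (y has_vector_derivative l * y t + k t $ i) (at t)) \<and>
    (\<forall>\<omega>. slowly_varying \<eta> \<omega> \<longrightarrow> (\<forall>s. norm (k s $ i) \<le> \<omega> s) \<longrightarrow> (\<forall>t. norm (y t) \<le> \<omega> t / (\<bar>Re l\<bar> - \<eta>)))"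
  proof
    fix i
    show "\<exists>y. (\<forall>t. (y has_vector_derivative l * y t + k t $ i) (at t)) \<and>
      (\<forall>\<omega>. slowly_varying \<eta> \<omega> \<longrightarrow> (\<forall>s. norm (k s $ i) \<le> \<omega> s) \<longrightarrow> (\<forall>t. norm (y t) \<le> \<omega> t / (\<bar>Re l\<bar> - \<eta>)))"
      by (rule scalar_bounded_solution[OF \<eta>, of _ M])
        (use k in \<open>auto intro!: continuous_intros intro: order_trans[OF Finite_Cartesian_Product.norm_nth_le]\<close>)
  qed
  then obtain y where "\<forall>i. (\<forall>t. (y i has_vector_derivative l * y i t + k t $ i) (at t)) \<and>
    (\<forall>\<omega>. slowly_varying \<eta> \<omega> \<longrightarrow> (\<forall>s. norm (k s $ i) \<le> \<omega> s) \<longrightarrow> (\<forall>t. norm (y i t) \<le> \<omega> t / (\<bar>Re l\<bar> - \<eta>)))"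
    unfolding choice_iff by blast
  then have y: "\<And>i t. (y i has_vector_derivative l * y i t + k t $ i) (at t)"
    and bound: "\<And>i \<omega> t. slowly_varying \<eta> \<omega> \<Longrightarrow> (\<And>s. norm (k s $ i) \<le> \<omega> s) \<Longrightarrow> norm (y i t) \<le> \<omega> t / (\<bar>Re l\<bar> - \<eta>)"
    by blast+
  show ?thesis
  proof (intro exI[of _ "\<lambda>t. \<chi> i. y i t"] conjI allI impI)
    show "((\<lambda>t. \<chi> i. y i t) has_vector_derivative l *s (\<chi> i. y i t) + k t) (at t)" for t
      by (rule has_vector_derivative_vecI) (simp add: y)
    fix \<omega> t assume \<omega>: "slowly_varying \<eta> \<omega>" "\<forall>s. norm (k s) \<le> \<omega> s"
    have "norm (\<chi> i. y i t) \<le> (\<Sum>i\<in>UNIV. norm (y i t))"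
      by (simp add: norm_vec_def L2_set_le_sum)
    also have "\<dots> \<le> (\<Sum>i\<in>(UNIV :: 'm set). \<omega> t / (\<bar>Re l\<bar> - \<eta>))"
      using \<omega> by (intro sum_mono bound) (auto intro: order_trans[OF Finite_Cartesian_Product.norm_nth_le])
    finally show "norm (\<chi> i. y i t) \<le> (CARD('m) / (\<bar>Re l\<bar> - \<eta>)) * \<omega> t" by simp
  qed
qed

lemma vector_exponential_bounded_imp_zero:
  fixes u :: "real \<Rightarrow> complex ^ 'm"
  assumes "Re l \<noteq> 0" "\<And>t. (u has_vector_derivative l *s u t) (at t)" "\<And>t. norm (u t) \<le> M"
  shows "u t = 0"
proof -
  have "u t $ i = 0" for i
  proof (rule exponential_bounded_imp_zero[OF assms(1)])
    show "((\<lambda>t. u t $ i) has_vector_derivative l * u t $ i) (at t)" for t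
      using bounded_linear.has_vector_derivative[OF bounded_linear_vec_nth assms(2)] by simp
    show "norm (u t $ i) \<le> M" for t
      using assms(3)[of t] Finite_Cartesian_Product.norm_nth_le order_trans by blast
  qed
  then show ?thesis by (simp add: vec_eq_iff)
qed

text \<open>
  Induction on the list (Putzer's scheme). Let \<open>g\<close> be the bounded solution of \<open>g' = l g + k\<close>. The
  product of all factors applied to \<open>g\<close> solves \<open>w' = l w\<close> and is bounded, hence \<open>0\<close>; so the source
  \<open>(A - l) g\<close> is annihilated by the remaining factors. If \<open>y\<close> solves the equation with that source,
  then \<open>(g + y)' = l g + k + A y + (A - l) g = A (g + y) + k\<close>. The constant \<open>c\<close> depends only on the
  list and on \<open>\<eta>\<close>, not on \<open>k\<close> or \<open>\<omega>\<close>.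
\<close>
lemma bounded_solution_by_factors:
  fixes A :: "complex ^ 'm ^ 'm"
  assumes "0 \<le> \<eta>" "\<And>l. l \<in> set ls \<Longrightarrow> \<eta> < \<bar>Re l\<bar>"
  shows "\<exists>c\<ge>0. \<forall>k M. continuous_on UNIV k \<longrightarrow> (\<forall>t. norm (k t) \<le> M) \<longrightarrow> (\<forall>t. linear_factors A ls (k t) = 0) \<longrightarrow>
    (\<exists>y. (\<forall>t. (y has_vector_derivative A *v y t + k t) (at t)) \<and>
      (\<forall>\<omega>. slowly_varying \<eta> \<omega> \<longrightarrow> (\<forall>s. norm (k s) \<le> \<omega> s) \<longrightarrow> (\<forall>t. norm (y t) \<le> c * \<omega> t)))"
  using assms(2)
proof (induction ls)
  case Nil
  show ?case
    by (intro exI[of _ 0] conjI allI impI exI[of _ "\<lambda>t. 0"]) auto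
next
  case (Cons l ls)
  then obtain c where "c \<ge> 0" and c: "\<And>k M. continuous_on UNIV k \<Longrightarrow> (\<And>t. norm (k t) \<le> M) \<Longrightarrow>
      (\<And>t. linear_factors A ls (k t) = 0) \<Longrightarrow>
    (\<exists>y. (\<forall>t. (y has_vector_derivative A *v y t + k t) (at t)) \<and>
      (\<forall>\<omega>. slowly_varying \<eta> \<omega> \<longrightarrow> (\<forall>s. norm (k s) \<le> \<omega> s) \<longrightarrow> (\<forall>t. norm (y t) \<le> c * \<omega> t)))"
    by fastforce
  have l: "\<eta> < \<bar>Re l\<bar>" "Re l \<noteq> 0" using Cons.prems[of l] \<open>0 \<le> \<eta>\<close> by auto
  define b where "b = CARD('m) / (\<bar>Re l\<bar> - \<eta>)"
  have "b \<ge> 0" using l by (simp add: b_def)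
  define S where "S = (\<lambda>v. A *v v - l *s v)"
  have "linear S" unfolding S_def by (intro linear_compose_sub linear_smult) simp
  then obtain N where "N > 0" and N: "\<And>v. norm (S v) \<le> N * norm v" using linear_bounded_pos by blast
  define c' where "c' = b + c * (N * b)"
  have "c' \<ge> 0" using \<open>c \<ge> 0\<close> \<open>b \<ge> 0\<close> \<open>N > 0\<close> by (simp add: c'_def)
  show ?case
  proof (intro exI[of _ c'] conjI allI impI \<open>c' \<ge> 0\<close>)
    fix k :: "real \<Rightarrow> complex ^ 'm" and M :: real
    assume k: "continuous_on UNIV k" "\<forall>t. norm (k t) \<le> M" and zero: "\<forall>t. linear_factors A (l # ls) (k t) = 0"
    obtain g where g: "\<And>t. (g has_vector_derivative l *s g t + k t) (at t)"
      and gb: "\<And>\<omega> t. slowly_varying \<eta> \<omega> \<Longrightarrow> (\<And>s. norm (k s) \<le> \<omega> s) \<Longrightarrow> norm (g t) \<le> b * \<omega> t"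
      using vector_bounded_solution[OF \<open>0 \<le> \<eta>\<close> l(1) k(1), of M] k(2) unfolding b_def by blast
    have "M \<ge> 0" using k(2) norm_ge_zero order_trans by blast
    have gM: "norm (g t) \<le> b * M" for t
      using gb[OF slowly_varying_const[OF \<open>0 \<le> \<eta>\<close> \<open>M \<ge> 0\<close>]] k(2) by simp
    let ?P = "linear_factors A (l # ls)"
    obtain N' where N': "\<And>v. norm (?P v) \<le> N' * norm v" "N' > 0"
      using linear_bounded_pos[OF linear_linear_factors] by blast
    have g0: "?P (g t) = 0" for t
    proof (rule vector_exponential_bounded_imp_zero[OF l(2)])
      show "((\<lambda>t. ?P (g t)) has_vector_derivative l *s ?P (g t)) (at t)" for t
        using has_vector_derivative_linear[OF linear_linear_factors g, of A "l # ls" t] zero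
        by (simp only: linear_factors_add linear_factors_smult add_0_right)
      show "norm (?P (g t)) \<le> N' * (b * M)" for t
        using N'(1)[of "g t"] mult_left_mono[OF gM[of t], of N'] N'(2) by linarith
    qed
    have "continuous_on UNIV (\<lambda>t. S (g t))"
      by (intro linear_continuous_on_compose[OF differentiable_continuous_on[OF g] \<open>linear S\<close>])
    moreover have "norm (S (g t)) \<le> N * (b * M)" for t
      using N[of "g t"] mult_left_mono[OF gM[of t], of N] \<open>N > 0\<close> by linarith
    moreover have "linear_factors A ls (S (g t)) = 0" for t
      using g0[of t] by (simp only: linear_factors_shift S_def)
    ultimately have "\<exists>y. (\<forall>t. (y has_vector_derivative A *v y t + S (g t)) (at t)) \<and>
      (\<forall>\<omega>. slowly_varying \<eta> \<omega> \<longrightarrow> (\<forall>s. norm (S (g s)) \<le> \<omega> s) \<longrightarrow> (\<forall>t. norm (y t) \<le> c * \<omega> t))"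
      by (rule c)
    then obtain y where y: "\<And>t. (y has_vector_derivative A *v y t + S (g t)) (at t)"
      and yb: "\<And>\<omega> t. slowly_varying \<eta> \<omega> \<Longrightarrow> (\<And>s. norm (S (g s)) \<le> \<omega> s) \<Longrightarrow> norm (y t) \<le> c * \<omega> t"
      by blast
    show "\<exists>y. (\<forall>t. (y has_vector_derivative A *v y t + k t) (at t)) \<and>
      (\<forall>\<omega>. slowly_varying \<eta> \<omega> \<longrightarrow> (\<forall>s. norm (k s) \<le> \<omega> s) \<longrightarrow> (\<forall>t. norm (y t) \<le> c' * \<omega> t))"
    proof (intro exI[of _ "\<lambda>t. g t + y t"] conjI allI impI)
      show "((\<lambda>t. g t + y t) has_vector_derivative A *v (g t + y t) + k t) (at t)" for t
        using has_vector_derivative_add[OF g[of t] y[of t]]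
        by (simp add: S_def matrix_vector_right_distrib algebra_simps)
      fix \<omega> t assume \<omega>: "slowly_varying \<eta> \<omega>" "\<forall>s. norm (k s) \<le> \<omega> s"
      have gw: "norm (g s) \<le> b * \<omega> s" for s using gb \<omega> by blast
      have "norm (S (g s)) \<le> (N * b) * \<omega> s" for s
        unfolding mult.assoc by (rule order_trans[OF N mult_left_mono[OF gw less_imp_le[OF \<open>N > 0\<close>]]])
      then have "norm (y t) \<le> c * ((N * b) * \<omega> t)"
        using yb[OF slowly_varying_scaled[OF _ \<omega>(1)], of "N * b" t] \<open>N > 0\<close> \<open>b \<ge> 0\<close> by simp
      then show "norm (g t + y t) \<le> c' * \<omega> t"
        using gw[of t] norm_triangle_ineq[of "g t" "y t"] by (simp add: c'_def algebra_simps)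
    qed
  qed
qed

text \<open>
  By induction \<open>(A - l) u\<close> vanishes, so \<open>u' = l u\<close>, and a nonzero exponential is unbounded on the
  line.
\<close>
lemma bounded_homogeneous_imp_zero:
  fixes A :: "complex ^ 'm ^ 'm"
  assumes "\<And>l. l \<in> set ls \<Longrightarrow> Re l \<noteq> 0" "\<And>t. linear_factors A ls (u t) = 0"
    "\<And>t. (u has_vector_derivative A *v u t) (at t)" "\<And>t. norm (u t) \<le> M"
  shows "u t = 0"
  using assms
proof (induction ls arbitrary: u M t)
  case (Cons l ls)
  define S where "S = (\<lambda>v. A *v v - l *s v)"
  have "linear S" unfolding S_def by (intro linear_compose_sub linear_smult) simp
  then obtain N where "N > 0" and N: "\<And>v. norm (S v) \<le> N * norm v" using linear_bounded_pos by blast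
  have "S (u t) = 0" for t
  proof (rule Cons.IH)
    show "linear_factors A ls (S (u t)) = 0" for t
      using Cons.prems(2)[of t] by (simp only: linear_factors_shift S_def)
    show "((\<lambda>t. S (u t)) has_vector_derivative A *v S (u t)) (at t)" for t
      using has_vector_derivative_linear[OF \<open>linear S\<close> Cons.prems(3)[of t]]
      by (simp add: S_def matrix_vector_mult_diff_distrib matrix_vector_mult_smult)
    show "norm (S (u t)) \<le> N * M" for t
      using N[of "u t"] mult_left_mono[OF Cons.prems(4)[of t], of N] \<open>N > 0\<close> by linarith
  qed (use Cons.prems(1) in auto)
  then have "A *v u t = l *s u t" for t by (simp add: S_def)
  then show ?case
    using vector_exponential_bounded_imp_zero[of l u M t] Cons.prems by auto
qed simp

lemma norm_vec_of_real: "norm (\<chi> i. complex_of_real (v $ i)) = norm v" for v :: "real ^ 'm"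
  by (simp add: norm_vec_def)

lemma norm_vec_Re: "norm (\<chi> i. Re (v $ i)) \<le> norm v" for v :: "complex ^ 'm"
  unfolding norm_vec_def by (intro L2_set_mono) (auto simp: abs_Re_le_cmod)

text \<open>
  The complex solution for a real source has a real part that solves the real equation. Uniqueness
  of bounded solutions makes the chosen solution depend linearly on \<open>k\<close>.
\<close>
lemma hyperbolic_solution_operator:
  fixes A :: "real ^ 'm ^ 'm"
  assumes "eigenvalues A \<noteq> {#}" "\<And>l. l \<in># eigenvalues A \<Longrightarrow> Re l \<noteq> 0"
  obtains \<eta> c and H :: "(real \<Rightarrow>\<^sub>C (real ^ 'm)) \<Rightarrow> (real \<Rightarrow>\<^sub>C (real ^ 'm))"
  where "\<eta> > 0" "c \<ge> 0" "linear H"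
    "\<And>k t. (apply_bcontfun (H k) has_vector_derivative A *v apply_bcontfun (H k) t + apply_bcontfun k t) (at t)"
    "\<And>k \<omega> t. slowly_varying \<eta> \<omega> \<Longrightarrow> (\<And>s. norm (apply_bcontfun k s) \<le> \<omega> s) \<Longrightarrow> norm (apply_bcontfun (H k) t) \<le> c * \<omega> t"
proof -
  let ?A = "map_matrix complex_of_real A"
  obtain ls where ls: "\<And>l. l \<in> set ls \<Longrightarrow> Re l \<noteq> 0" "\<And>v. linear_factors ?A ls v = 0"
    using hyperbolic_annihilator[OF assms] by blast
  obtain \<eta> where \<eta>: "\<eta> > 0" "\<And>l. l \<in> set ls \<Longrightarrow> \<eta> < \<bar>Re l\<bar>"
  proof -
    define m where "m = Min (insert 1 ((\<lambda>l. \<bar>Re l\<bar>) ` set ls))"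
    have "m > 0" unfolding m_def using ls(1) by (subst Min_gr_iff) auto
    moreover have "m \<le> \<bar>Re l\<bar>" if "l \<in> set ls" for l
      unfolding m_def using that by (intro Min_le) auto
    ultimately have "m / 2 > 0" "m / 2 < \<bar>Re l\<bar>" if "l \<in> set ls" for l
      using that by fastforce+
    with \<open>m > 0\<close> show thesis by (intro that[of "m / 2"]) auto
  qed
  let ?C = "\<lambda>v :: real ^ 'm. \<chi> i. complex_of_real (v $ i)" and ?Re = "\<lambda>v :: complex ^ 'm. \<chi> i. Re (v $ i)"
  have linC: "linear ?C" by (intro linearI) (auto simp: vec_eq_iff scaleR_conv_of_real[where 'a = complex])
  have linRe: "linear ?Re" by (intro linearI) (auto simp: vec_eq_iff)
  have C_mult: "?A *v ?C v = ?C (A *v v)" for v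
    by (simp add: vec_eq_iff matrix_vector_mult_def map_matrix_def)
  have Re_mult: "?Re (?A *v w) = A *v ?Re w" for w
    by (simp add: vec_eq_iff matrix_vector_mult_def map_matrix_def)
  obtain c where "c \<ge> 0" and c: "\<And>k M. continuous_on UNIV k \<Longrightarrow> (\<And>t. norm (k t) \<le> M) \<Longrightarrow>
    (\<exists>y. (\<forall>t. (y has_vector_derivative ?A *v y t + k t) (at t)) \<and>
      (\<forall>\<omega>. slowly_varying \<eta> \<omega> \<longrightarrow> (\<forall>s. norm (k s) \<le> \<omega> s) \<longrightarrow> (\<forall>t. norm (y t) \<le> c * \<omega> t)))"
    using bounded_solution_by_factors[of \<eta> ls ?A] \<eta> ls(2) by fastforce
  have unique: "u = 0" if "\<And>t. (u has_vector_derivative A *v u t) (at t)" for u :: "real \<Rightarrow>\<^sub>C (real ^ 'm)"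
  proof (rule bcontfun_eqI)
    fix t
    have "?C (u t) = 0"
    proof (rule bounded_homogeneous_imp_zero[of ls ?A "\<lambda>t. ?C (u t)" "norm u"])
      show "((\<lambda>t. ?C (u t)) has_vector_derivative ?A *v ?C (u t)) (at t)" for t
        using has_vector_derivative_linear[OF linC that[of t]] unfolding C_mult .
      show "norm (?C (u t)) \<le> norm u" for t
        unfolding norm_vec_of_real by (rule norm_bounded)
    qed (use ls in auto)
    then show "u t = apply_bcontfun 0 t" by (simp add: vec_eq_iff)
  qed
  have "\<forall>k :: real \<Rightarrow>\<^sub>C (real ^ 'm). \<exists>y :: real \<Rightarrow>\<^sub>C (real ^ 'm). (\<forall>t. (y has_vector_derivative A *v y t + k t) (at t)) \<and>
    (\<forall>\<omega>. slowly_varying \<eta> \<omega> \<longrightarrow> (\<forall>s. norm (k s) \<le> \<omega> s) \<longrightarrow> (\<forall>t. norm (y t) \<le> c * \<omega> t))"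
  proof
    fix k :: "real \<Rightarrow>\<^sub>C (real ^ 'm)"
    have "\<exists>y. (\<forall>t. (y has_vector_derivative ?A *v y t + ?C (k t)) (at t)) \<and>
      (\<forall>\<omega>. slowly_varying \<eta> \<omega> \<longrightarrow> (\<forall>s. norm (?C (k s)) \<le> \<omega> s) \<longrightarrow> (\<forall>t. norm (y t) \<le> c * \<omega> t))"
    proof (rule c)
      show "continuous_on UNIV (\<lambda>t. ?C (k t))"
        by (rule linear_continuous_on_compose[OF _ linC]) simp
      show "norm (?C (k t)) \<le> norm k" for t
        unfolding norm_vec_of_real by (rule norm_bounded)
    qed
    then obtain y where y: "\<And>t. (y has_vector_derivative ?A *v y t + ?C (k t)) (at t)"
      and yb: "\<And>\<omega> t. slowly_varying \<eta> \<omega> \<Longrightarrow> (\<And>s. norm (?C (k s)) \<le> \<omega> s) \<Longrightarrow> norm (y t) \<le> c * \<omega> t"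
      by blast
    define z where "z = (\<lambda>t. ?Re (y t))"
    have z: "(z has_vector_derivative A *v z t + k t) (at t)" for t
    proof -
      have "?Re (?A *v y t + ?C (k t)) = A *v z t + k t"
        unfolding linear_add[OF linRe] Re_mult z_def by (simp add: vec_eq_iff)
      then show ?thesis
        using has_vector_derivative_linear[OF linRe y[of t]] by (simp only: z_def)
    qed
    have zb: "norm (z t) \<le> c * \<omega> t" if "slowly_varying \<eta> \<omega>" "\<And>s. norm (k s) \<le> \<omega> s" for \<omega> t
      using yb[OF that(1), of t] that(2) norm_vec_Re[of "y t"] unfolding z_def norm_vec_of_real by fastforce
    have "norm (z t) \<le> c * norm k" for t
      using zb[OF slowly_varying_const[of \<eta> "norm k"]] \<eta>(1) norm_bounded[of k] by simp
    then have "z \<in> bcontfun"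
      using differentiable_continuous_on[OF z] by (rule bcontfun_normI[rotated])
    then obtain y' where "z = apply_bcontfun y'" by (rule bcontfunE)
    then show "\<exists>y :: real \<Rightarrow>\<^sub>C (real ^ 'm). (\<forall>t. (y has_vector_derivative A *v y t + k t) (at t)) \<and>
      (\<forall>\<omega>. slowly_varying \<eta> \<omega> \<longrightarrow> (\<forall>s. norm (k s) \<le> \<omega> s) \<longrightarrow> (\<forall>t. norm (y t) \<le> c * \<omega> t))"
      using z zb by (intro exI[of _ y']) auto
  qed
  then obtain H :: "(real \<Rightarrow>\<^sub>C (real ^ 'm)) \<Rightarrow> (real \<Rightarrow>\<^sub>C (real ^ 'm))"
    where H: "\<And>k t. (apply_bcontfun (H k) has_vector_derivative A *v apply_bcontfun (H k) t + apply_bcontfun k t) (at t)"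
      "\<And>k \<omega> t. slowly_varying \<eta> \<omega> \<Longrightarrow> (\<And>s. norm (apply_bcontfun k s) \<le> \<omega> s) \<Longrightarrow> norm (apply_bcontfun (H k) t) \<le> c * \<omega> t"
    unfolding choice_iff by blast
  have "linear H"
  proof (intro linearI)
    fix k k' :: "real \<Rightarrow>\<^sub>C (real ^ 'm)" and r :: real
    have "H (k + k') - H k - H k' = 0"
    proof (rule unique)
      fix t
      show "(apply_bcontfun (H (k + k') - H k - H k') has_vector_derivative A *v (H (k + k') - H k - H k') t) (at t)"
        using has_vector_derivative_diff[OF has_vector_derivative_diff[OF H(1)[of "k + k'" t] H(1)[of k t]] H(1)[of k' t]]
        unfolding minus_bcontfun.rep_eq by (simp add: matrix_vector_mult_diff_distrib algebra_simps)
    qed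
    then show "H (k + k') = H k + H k'" by (simp add: algebra_simps)
    have "H (r *\<^sub>R k) - r *\<^sub>R H k = 0"
    proof (rule unique)
      fix t
      have "((\<lambda>t. r *\<^sub>R H k t) has_vector_derivative r *\<^sub>R (A *v H k t + k t)) (at t)"
        using has_vector_derivative_linear[OF linear_scale_self H(1)[of k t]] by blast
      from has_vector_derivative_diff[OF H(1)[of "r *\<^sub>R k" t] this]
      show "(apply_bcontfun (H (r *\<^sub>R k) - r *\<^sub>R H k) has_vector_derivative A *v (H (r *\<^sub>R k) - r *\<^sub>R H k) t) (at t)"
        by (simp add: matrix_vector_mult_diff_distrib linear_cmul[OF matrix_vector_mul_linear] algebra_simps)
    qed
    then show "H (r *\<^sub>R k) = r *\<^sub>R H k" by simp
  qed
  then show thesis using that \<eta>(1) \<open>c \<ge> 0\<close> H by blast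
qed

section \<open>Finite-rank perturbations of contractions\<close>

text \<open>
  The image of a basis of \<open>span F\<close> is independent of the same cardinality, so it cannot be enlarged
  within \<open>span F\<close>.
\<close>
lemma injective_on_finite_span_imp_surjective:
  fixes T :: "'a::real_vector \<Rightarrow> 'a"
  assumes "linear T" "finite F" "T ` span F \<subseteq> span F" "\<And>x. x \<in> span F \<Longrightarrow> T x = 0 \<Longrightarrow> x = 0"
  shows "span F \<subseteq> T ` span F"
proof
  fix y assume y: "y \<in> span F"
  obtain B where B: "B \<subseteq> F" "independent B" "F \<subseteq> span B"
    using maximal_independent_subset[of F] by blast
  have spanB: "span B = span F"
    using B by (metis span_mono span_span subset_antisym)
  have finB: "finite B" using B(1) \<open>finite F\<close> finite_subset by blast
  have inj: "inj_on T (span B)"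
  proof (rule inj_onI)
    fix x y assume "x \<in> span B" "y \<in> span B" "T x = T y"
    then show "x = y"
      using assms(4)[of "x - y"] spanB by (simp add: span_diff linear_diff[OF \<open>linear T\<close>])
  qed
  have ind: "independent (T ` B)"
    by (rule linear_independent_injective_image[OF \<open>linear T\<close> B(2) inj])
  have card: "card (T ` B) = card B"
    by (intro card_image inj_on_subset[OF inj] span_superset)
  have sub: "T ` B \<subseteq> span B" using assms(3) spanB span_superset by blast
  have "y \<in> span (T ` B)"
  proof (rule ccontr)
    assume no: "y \<notin> span (T ` B)"
    then have "independent (insert y (T ` B))" using ind by (simp add: independent_insert)
    moreover have "insert y (T ` B) \<subseteq> span B" using y sub spanB by simp
    ultimately have "card (insert y (T ` B)) \<le> card B"
      using independent_span_bound[OF finB] by blast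
    moreover have "y \<notin> T ` B" using no span_base[of y "T ` B"] by argo
    ultimately show False using card finB by simp
  qed
  then show "y \<in> T ` span F"
    using linear_span_image[OF \<open>linear T\<close>, of B] spanB by simp
qed

text \<open>
  Let \<open>Q\<close> be the inverse of \<open>1 - E\<close>, which exists by the contraction principle. The equation
  \<open>x = K x + u\<close> becomes \<open>T x = Q u\<close> with \<open>T = 1 - \<Sum> g\<^sub>i Q \<phi>\<^sub>i\<close>, and \<open>T\<close> maps the span of the
  \<open>Q \<phi>\<^sub>i\<close> injectively to itself, hence onto. With preimages \<open>\<psi>\<^sub>i\<close> of \<open>Q \<phi>\<^sub>i\<close>, the solution is
  \<open>x = Q u + \<Sum> g\<^sub>i(Q u) \<psi>\<^sub>i\<close>, and the finitely many norms of the \<open>\<psi>\<^sub>i\<close> enter the bound \<open>C\<close>.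
\<close>
lemma finite_rank_perturbation_invertible:
  fixes K E :: "'a::{real_normed_vector, complete_space} \<Rightarrow> 'a" and \<phi> :: "'i \<Rightarrow> 'a"
  assumes "linear K" "linear E" "finite S"
    and K: "\<And>x. K x = E x + (\<Sum>i\<in>S. g i x *\<^sub>R \<phi> i)"
    and g: "\<And>i. i \<in> S \<Longrightarrow> linear (g i)" "\<And>i x. i \<in> S \<Longrightarrow> \<bar>g i x\<bar> \<le> G * norm x"
    and E: "q < 1" "\<And>x. norm (E x) \<le> q * norm x"
    and inj: "\<And>x. K x = x \<Longrightarrow> x = 0"
  shows "\<exists>C\<ge>0. \<forall>u. \<exists>x. x = K x + u \<and> norm x \<le> C * norm u"
proof -
  have ex1: "\<exists>!x. E x + u = x" for u
  proof (rule banach_fix_type)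
    show "0 \<le> max q 0" "max q 0 < 1" using E(1) by auto
    show "\<forall>x y. dist (E x + u) (E y + u) \<le> max q 0 * dist x y"
    proof (intro allI)
      fix x y
      have "dist (E x + u) (E y + u) = norm (E (x - y))"
        by (simp add: dist_norm linear_diff[OF \<open>linear E\<close>])
      also have "\<dots> \<le> q * norm (x - y)" by (rule E(2))
      also have "\<dots> \<le> max q 0 * norm (x - y)" by (intro mult_right_mono) auto
      finally show "dist (E x + u) (E y + u) \<le> max q 0 * dist x y" by (simp add: dist_norm)
    qed
  qed
  define Q where "Q = (\<lambda>u. THE x. E x + u = x)"
  have Q: "E (Q u) + u = Q u" for u unfolding Q_def by (rule theI'[OF ex1])
  have Q_eq: "Q u = x" if "E x + u = x" for u x using ex1[of u] Q[of u] that by blast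
  have "linear Q"
  proof (intro linearI Q_eq)
    show "E (Q u + Q v) + (u + v) = Q u + Q v" for u v
      using Q[of u] Q[of v] by (simp add: linear_add[OF \<open>linear E\<close>] algebra_simps)
    show "E (r *\<^sub>R Q u) + r *\<^sub>R u = r *\<^sub>R Q u" for r u
      using Q[of u] by (simp add: linear_cmul[OF \<open>linear E\<close>] flip: scaleR_right_distrib)
  qed
  have norm_Q: "norm (Q u) \<le> norm u / (1 - q)" for u
  proof -
    have "norm (Q u) \<le> norm (E (Q u)) + norm u" using Q[of u] norm_triangle_ineq by metis
    then show ?thesis using E(2)[of "Q u"] E(1) by (simp add: field_simps)
  qed
  let ?F = "\<lambda>x. \<Sum>i\<in>S. g i x *\<^sub>R \<phi> i"
  define T where "T = (\<lambda>x. x - (\<Sum>i\<in>S. g i x *\<^sub>R Q (\<phi> i)))"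
  have "linear T"
    unfolding T_def
    by (intro linearI)
      (simp_all add: linear_add[OF g(1)] linear_cmul[OF g(1)] scaleR_left_distrib sum.distrib
        scaleR_right_diff_distrib scaleR_sum_right cong: sum.cong)
  have QF: "Q (?F x) = (\<Sum>i\<in>S. g i x *\<^sub>R Q (\<phi> i))" for x
    by (simp add: linear_sum[OF \<open>linear Q\<close>] linear_cmul[OF \<open>linear Q\<close>])
  have T_eq: "T x = Q u \<longleftrightarrow> x = K x + u" for x u
  proof
    assume "T x = Q u"
    then have x: "x = Q (?F x + u)"
      by (simp add: T_def QF linear_add[OF \<open>linear Q\<close>] algebra_simps)
    show "x = K x + u"
      using Q[of "?F x + u"] unfolding x[symmetric] K by (simp add: add_ac)
  next
    assume "x = K x + u"
    then have "Q (?F x + u) = x" by (intro Q_eq) (simp add: K add_ac)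
    then show "T x = Q u"
      by (simp add: T_def QF linear_add[OF \<open>linear Q\<close>] algebra_simps)
  qed
  let ?Y = "span ((\<lambda>i. Q (\<phi> i)) ` S)"
  have surj: "?Y \<subseteq> T ` ?Y"
  proof (rule injective_on_finite_span_imp_surjective[OF \<open>linear T\<close>])
    have "g i x *\<^sub>R Q (\<phi> i) \<in> ?Y" if "i \<in> S" for i x
      using that by (intro span_scale span_base) auto
    then show "T ` ?Y \<subseteq> ?Y"
      unfolding T_def by (auto intro!: span_diff span_sum)
    show "x = 0" if "T x = 0" for x
      using T_eq[of x 0] that inj[of x] linear_0[OF \<open>linear Q\<close>] by simp
  qed (use \<open>finite S\<close> in simp)
  have "\<forall>i\<in>S. \<exists>\<psi>. T \<psi> = Q (\<phi> i)"
    using surj span_base[of _ "(\<lambda>i. Q (\<phi> i)) ` S"] by (metis (no_types, lifting) image_iff subsetD)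
  then obtain \<psi> where \<psi>: "\<And>i. i \<in> S \<Longrightarrow> T (\<psi> i) = Q (\<phi> i)" by metis
  define C where "C = (1 + \<bar>G\<bar> * (\<Sum>i\<in>S. norm (\<psi> i))) / (1 - q)"
  have "C \<ge> 0" unfolding C_def using E(1) by (intro divide_nonneg_nonneg add_nonneg_nonneg mult_nonneg_nonneg sum_nonneg) auto
  moreover have "\<exists>x. x = K x + u \<and> norm x \<le> C * norm u" for u
  proof (intro exI conjI)
    let ?x = "Q u + (\<Sum>i\<in>S. g i (Q u) *\<^sub>R \<psi> i)"
    have "T ?x = T (Q u) + (\<Sum>i\<in>S. g i (Q u) *\<^sub>R Q (\<phi> i))"
      by (simp add: linear_add[OF \<open>linear T\<close>] linear_sum[OF \<open>linear T\<close>] linear_cmul[OF \<open>linear T\<close>] \<psi>)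
    also have "\<dots> = Q u" by (simp add: T_def)
    finally show "?x = K ?x + u" by (simp only: T_eq)
    have "norm (\<Sum>i\<in>S. g i (Q u) *\<^sub>R \<psi> i) \<le> (\<Sum>i\<in>S. \<bar>G\<bar> * norm (Q u) * norm (\<psi> i))"
    proof (intro order_trans[OF norm_sum] sum_mono)
      fix i assume "i \<in> S"
      have "\<bar>g i (Q u)\<bar> \<le> \<bar>G\<bar> * norm (Q u)"
        using g(2)[OF \<open>i \<in> S\<close>, of "Q u"] mult_right_mono[OF abs_ge_self[of G] norm_ge_zero[of "Q u"]] by linarith
      then show "norm (g i (Q u) *\<^sub>R \<psi> i) \<le> \<bar>G\<bar> * norm (Q u) * norm (\<psi> i)"
        by (simp add: mult_right_mono)
    qed
    then have "norm ?x \<le> norm (Q u) + \<bar>G\<bar> * norm (Q u) * (\<Sum>i\<in>S. norm (\<psi> i))"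
      using norm_triangle_ineq[of "Q u" "\<Sum>i\<in>S. g i (Q u) *\<^sub>R \<psi> i"] by (simp add: sum_distrib_left)
    also have "\<dots> = (1 + \<bar>G\<bar> * (\<Sum>i\<in>S. norm (\<psi> i))) * norm (Q u)" by (simp add: algebra_simps)
    also have "\<dots> \<le> (1 + \<bar>G\<bar> * (\<Sum>i\<in>S. norm (\<psi> i))) * (norm u / (1 - q))"
      by (intro mult_left_mono norm_Q add_nonneg_nonneg mult_nonneg_nonneg sum_nonneg) auto
    finally show "norm ?x \<le> C * norm u" by (simp add: C_def)
  qed
  ultimately show ?thesis by blast
qed

section \<open>Reversible linear systems asymptotic to a hyperbolic matrix\<close>

lemma apply_Bcontfun:
  assumes "continuous_on UNIV f" "\<And>t. norm (f t) \<le> b"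
  shows "apply_bcontfun (Bcontfun f) = f"
  by (rule Bcontfun_inverse[OF bcontfun_normI[OF assms]])

lemma apply_bcontfun_sum: "apply_bcontfun (sum f S) t = (\<Sum>i\<in>S. apply_bcontfun (f i) t)"
  for f :: "'i \<Rightarrow> 'a::topological_space \<Rightarrow>\<^sub>C 'b::real_normed_vector"
  by (induction S rule: infinite_finite_induct) auto

text \<open>
  Cauchy-Schwarz in each row.
\<close>
lemma norm_matrix_vector_mult_le: "norm (M *v v) \<le> norm M * norm v" for M :: "real ^ 'm ^ 'm"
proof -
  have "norm (M *v v) \<le> L2_set (\<lambda>i. norm (M $ i) * norm v) UNIV"
    unfolding norm_vec_def[of "M *v v"]
    by (intro L2_set_mono) (auto simp: matrix_vector_mul_component Cauchy_Schwarz_ineq2)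
  then show ?thesis by (simp add: norm_vec_def[of M] L2_set_left_distrib)
qed

lemma continuous_vanishing_imp_bounded:
  fixes u :: "real \<Rightarrow> 'a::real_normed_vector"
  assumes "continuous_on UNIV u" "(u \<longlongrightarrow> 0) at_infinity"
  shows "\<exists>M>0. \<forall>t. norm (u t) \<le> M"
proof -
  obtain T where T: "\<And>t. \<bar>t\<bar> \<ge> T \<Longrightarrow> norm (u t) < 1"
    using assms(2)[unfolded Lim_at_infinity, rule_format, of 1] by (auto simp: dist_norm)
  have "bounded (u ` {-T..T})"
    by (intro compact_imp_bounded compact_continuous_image continuous_on_subset[OF assms(1)]) auto
  then obtain N where "N > 0" and N: "\<And>t. t \<in> {-T..T} \<Longrightarrow> norm (u t) \<le> N"
    unfolding bounded_pos by auto
  have "norm (u t) \<le> N + 1" for t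
  proof (cases "\<bar>t\<bar> \<ge> T")
    case True
    then show ?thesis using T[OF True] \<open>N > 0\<close> by linarith
  next
    case False
    then have "t \<in> {-T..T}" by auto
    then show ?thesis using N by fastforce
  qed
  then show ?thesis using \<open>N > 0\<close> by (intro exI[of _ "N + 1"]) auto
qed

lemma vanishing_imp_slowly_varying_bound:
  fixes u :: "real \<Rightarrow> 'a::real_normed_vector"
  assumes "\<eta> \<ge> 0" "(u \<longlongrightarrow> 0) at_infinity" "\<And>t. norm (u t) \<le> M" "\<epsilon> > 0"
  shows "\<exists>C\<ge>0. \<forall>t. norm (u t) \<le> \<epsilon> + C * exp (- \<eta> * \<bar>t\<bar>)"
proof -
  obtain T where T: "\<And>t. \<bar>t\<bar> \<ge> T \<Longrightarrow> norm (u t) < \<epsilon>"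
    using assms(2)[unfolded Lim_at_infinity, rule_format, OF assms(4)] by (auto simp: dist_norm)
  have "M \<ge> 0" using assms(3)[of 0] norm_ge_zero order_trans by blast
  have "norm (u t) \<le> \<epsilon> + (M * exp (\<eta> * T)) * exp (- \<eta> * \<bar>t\<bar>)" for t
  proof (cases "\<bar>t\<bar> \<ge> T")
    case True
    then show ?thesis using T[of t] \<open>M \<ge> 0\<close> by (simp add: add_increasing2 less_imp_le)
  next
    case False
    then have "0 \<le> \<eta> * T + - \<eta> * \<bar>t\<bar>"
      using mult_left_mono[of "\<bar>t\<bar>" T \<eta>] \<open>\<eta> \<ge> 0\<close> by simp
    then have "1 \<le> exp (\<eta> * T) * exp (- \<eta> * \<bar>t\<bar>)" by (simp flip: exp_add)
    then have "M * 1 \<le> M * (exp (\<eta> * T) * exp (- \<eta> * \<bar>t\<bar>))"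
      using \<open>M \<ge> 0\<close> by (rule mult_left_mono)
    then show ?thesis using assms(3)[of t] \<open>\<epsilon> > 0\<close> by (simp add: mult.assoc)
  qed
  then show ?thesis using \<open>M \<ge> 0\<close> by (intro exI[of _ "M * exp (\<eta> * T)"]) auto
qed

lemma slowly_varying_bound_small_outside:
  fixes \<eta> \<epsilon> C :: real
  assumes "\<eta> > 0" "\<epsilon> > 0" "C \<ge> 0"
  shows "\<exists>T>0. \<forall>t. \<bar>t\<bar> \<ge> T \<longrightarrow> \<epsilon> + C * exp (- \<eta> * \<bar>t\<bar>) \<le> 2 * \<epsilon>"
proof (intro exI[of _ "(C / \<epsilon> + 1) / \<eta>"] conjI allI impI)
  show "(C / \<epsilon> + 1) / \<eta> > 0" using assms by (intro divide_pos_pos add_nonneg_pos) auto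
  fix t assume "(C / \<epsilon> + 1) / \<eta> \<le> \<bar>t\<bar>"
  then have "C / \<epsilon> \<le> \<eta> * \<bar>t\<bar>" using assms by (simp add: field_simps)
  also have "\<dots> \<le> exp (\<eta> * \<bar>t\<bar>)" using exp_ge_add_one_self[of "\<eta> * \<bar>t\<bar>"] by linarith
  finally have "C \<le> \<epsilon> * exp (\<eta> * \<bar>t\<bar>)" using \<open>\<epsilon> > 0\<close> by (simp add: field_simps)
  then show "\<epsilon> + C * exp (- \<eta> * \<bar>t\<bar>) \<le> 2 * \<epsilon>" by (simp add: exp_minus field_simps)
qed

text \<open>
  Tent functions around a finite net of \<open>[-T, T]\<close>, normalized by their sum plus a function that is
  positive exactly outside \<open>[-T, T]\<close>.
\<close>
lemma finite_partition_of_unity_line: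
  fixes T h :: real
  assumes "h > 0"
  shows "\<exists>S (w :: real \<Rightarrow> real \<Rightarrow> real). finite S \<and> (\<forall>s. continuous_on UNIV (w s)) \<and> (\<forall>s t. 0 \<le> w s t) \<and>
    (\<forall>t. (\<Sum>s\<in>S. w s t) \<le> 1) \<and> (\<forall>t. \<bar>t\<bar> \<le> T \<longrightarrow> (\<Sum>s\<in>S. w s t) = 1) \<and>
    (\<forall>s t. w s t \<noteq> 0 \<longrightarrow> \<bar>t - s\<bar> \<le> h)"
proof -
  have "compact {-T..T}" by simp
  then obtain S where "finite S" and S: "{-T..T} \<subseteq> (\<Union>s\<in>S. ball s h)"
    unfolding compact_eq_totally_bounded using \<open>h > 0\<close> by blast
  define b where "b = (\<lambda>s t :: real. max 0 (h - \<bar>t - s\<bar>))"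
  define D where "D = (\<lambda>t. (\<Sum>s\<in>S. b s t) + max 0 (\<bar>t\<bar> - T))"
  have b: "b s t \<ge> 0" for s t by (simp add: b_def)
  then have sum0: "(\<Sum>s\<in>S. b s t) \<ge> 0" for t by (simp add: sum_nonneg)
  have D: "D t > 0" for t
  proof (cases "\<bar>t\<bar> \<le> T")
    case True
    then have "t \<in> {-T..T}" by auto
    then have "t \<in> (\<Union>s\<in>S. ball s h)" using S by blast
    then obtain s where "s \<in> S" "\<bar>t - s\<bar> < h" by (auto simp: dist_real_def abs_minus_commute)
    then have "(\<Sum>s\<in>S. b s t) > 0"
      using \<open>finite S\<close> b by (intro sum_pos2[of S s]) (auto simp: b_def)
    then show ?thesis by (simp add: D_def add_pos_nonneg)
  next
    case False
    then show ?thesis using sum0[of t] by (simp add: D_def add_nonneg_pos)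
  qed
  have sum: "(\<Sum>s\<in>S. b s t / D t) = (\<Sum>s\<in>S. b s t) / D t" for t
    by (simp add: sum_divide_distrib)
  show ?thesis
  proof (intro exI[of _ S] exI[of _ "\<lambda>s t. b s t / D t"] conjI allI impI \<open>finite S\<close>)
    show "continuous_on UNIV (\<lambda>t. b s t / D t)" for s
      using D unfolding b_def D_def by (intro continuous_intros) (auto simp: less_imp_neq[symmetric])
    show "0 \<le> b s t / D t" for s t using b[of s t] D[of t] by simp
    show "(\<Sum>s\<in>S. b s t / D t) \<le> 1" for t
      unfolding sum using D[of t] by (simp add: D_def)
    show "(\<Sum>s\<in>S. b s t / D t) = 1" if "\<bar>t\<bar> \<le> T" for t
      unfolding sum using D[of t] that by (simp add: D_def)
    show "\<bar>t - s\<bar> \<le> h" if "b s t / D t \<noteq> 0" for s t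
      using that by (auto simp: b_def max_def split: if_splits)
  qed
qed

text \<open>
  The symmetric functions are the fixed points of this map. On the line, \<open>y\<close> solves a reversible
  equation with source \<open>h\<close> if and only if its reversal solves it with minus the reversal of \<open>h\<close>.
\<close>
definition time_reversal :: "('a \<Rightarrow> 'a) \<Rightarrow> (real \<Rightarrow>\<^sub>C 'a::real_normed_vector) \<Rightarrow> (real \<Rightarrow>\<^sub>C 'a)" where
  "time_reversal R u = Bcontfun (\<lambda>t. R (u (- t)))"

lemma apply_time_reversal:
  fixes R :: "'a::euclidean_space \<Rightarrow> 'a"
  assumes "linear R"
  shows "time_reversal R u t = R (u (- t))"
proof -
  obtain r where r: "r > 0" "\<And>v. norm (R v) \<le> r * norm v" using linear_bounded_pos[OF assms] by blast
  have "norm (R (u t)) \<le> r * norm u" for t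
    using r(2)[of "u t"] mult_left_mono[OF norm_bounded[of u t], of r] r(1) by linarith
  moreover have "continuous_on UNIV (\<lambda>t. R (u (- t)))"
    by (intro linear_continuous_on_compose[OF _ assms] continuous_on_compose2[OF continuous_on_apply_bcontfun] continuous_intros) auto
  ultimately show ?thesis
    unfolding time_reversal_def by (subst apply_Bcontfun) auto
qed

lemma linear_time_reversal:
  fixes R :: "'a::euclidean_space \<Rightarrow> 'a"
  assumes "linear R"
  shows "linear (time_reversal R)"
  by (intro linearI bcontfun_eqI) (simp_all add: apply_time_reversal assms linear_add linear_cmul)

text \<open>
  The system \<open>y' = (A + B(t)) y\<close>. For the variational equation along a symmetric homoclinic orbit,
  \<open>A\<close> is the Jacobian at the equilibrium. The nonempty multiset of eigenvalues excludes a vanishing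
  characteristic polynomial, whose multiset of roots is empty by convention.
\<close>
locale reversible_linear_system =
  fixes A :: "real ^ 'm ^ 'm" and B :: "real \<Rightarrow> real ^ 'm ^ 'm" and R :: "real ^ 'm \<Rightarrow> real ^ 'm"
  assumes hyperbolic: "eigenvalues A \<noteq> {#}" "\<And>l. l \<in># eigenvalues A \<Longrightarrow> Re l \<noteq> 0"
    and B: "continuous_on UNIV B" "(B \<longlongrightarrow> 0) at_infinity"
    and R: "linear R" "\<And>v. R (R v) = v"
    and reversible: "\<And>v. A *v R v = - R (A *v v)" "\<And>t v. B (- t) *v R v = - R (B t *v v)"
begin

abbreviation "rev_time \<equiv> time_reversal R"

lemma rev_time_involution: "rev_time (rev_time u) = u"
  by (rule bcontfun_eqI) (simp add: apply_time_reversal R)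

definition perturbation :: "(real \<Rightarrow>\<^sub>C (real ^ 'm)) \<Rightarrow> (real \<Rightarrow>\<^sub>C (real ^ 'm))" where
  "perturbation y = Bcontfun (\<lambda>t. B t *v y t)"

lemma bounded_B: "\<exists>M>0. \<forall>t. norm (B t) \<le> M"
  by (rule continuous_vanishing_imp_bounded[OF B])

lemma norm_B_mult_le: "norm (B t *v apply_bcontfun y t) \<le> norm (B t) * norm y"
  using norm_matrix_vector_mult_le[of "B t" "y t"] mult_left_mono[OF norm_bounded[of y t], of "norm (B t)"]
  by simp

lemma apply_perturbation: "perturbation y t = B t *v y t"
proof -
  obtain M where M: "\<And>t. norm (B t) \<le> M" using bounded_B by blast
  have "continuous_on UNIV (\<lambda>t. B t *v y t)"
    unfolding matrix_vector_mult_def using B(1) by (intro continuous_intros) auto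
  moreover have "norm (B t *v y t) \<le> M * norm y" for t
    using norm_B_mult_le[of t y] mult_right_mono[OF M[of t] norm_ge_zero[of y]] by linarith
  ultimately show ?thesis unfolding perturbation_def by (subst apply_Bcontfun) auto
qed

lemma linear_perturbation: "linear perturbation"
  by (intro linearI bcontfun_eqI)
    (simp_all add: apply_perturbation matrix_vector_right_distrib linear_cmul[OF matrix_vector_mul_linear])

lemma perturbation_vanishes: "(perturbation y \<longlongrightarrow> 0) at_infinity"
proof (rule Lim_null_comparison)
  show "\<forall>\<^sub>F t in at_infinity. norm (perturbation y t) \<le> norm (B t) * norm y"
    by (simp add: apply_perturbation norm_B_mult_le)
  show "((\<lambda>t. norm (B t) * norm y) \<longlongrightarrow> 0) at_infinity"
    using tendsto_mult_right[OF tendsto_norm[OF B(2)], of "norm y"] by simp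
qed

lemma rev_time_perturbation: "rev_time (perturbation y) = - perturbation (rev_time y)"
proof (rule bcontfun_eqI)
  fix t
  show "rev_time (perturbation y) t = (- perturbation (rev_time y)) t"
    using reversible(2)[of "- t" "y (- t)"] by (simp add: apply_time_reversal R apply_perturbation)
qed

lemma reversed_solution:
  assumes "\<And>t. (u has_vector_derivative A *v u t + k t) (at t)"
  shows "((\<lambda>t. R (u (- t))) has_vector_derivative A *v R (u (- t)) - R (k (- t))) (at t)"
proof -
  have "((\<lambda>t. R (u (- t))) has_vector_derivative R (- (A *v u (- t) + k (- t)))) (at t)"
    by (intro has_vector_derivative_linear[OF R(1)] has_vector_derivative_reflect assms)
  then show ?thesis by (simp add: linear_neg[OF R(1)] linear_add[OF R(1)] linear_diff[OF R(1)] reversible(1))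
qed

text \<open>
  \<open>G k\<close> is the average of the bounded solution of \<open>u' = A u + k\<close> and its time reversal. It is
  defined for every \<open>k\<close>, which keeps it a linear operator on the whole Banach space, but it solves
  the equation for those \<open>k\<close> with \<open>k(-t) = -R k(t)\<close>, since only then is the reversal a solution with
  the same source.
\<close>
lemma symmetric_solution_operator:
  obtains \<eta> c \<Lambda> and G :: "(real \<Rightarrow>\<^sub>C (real ^ 'm)) \<Rightarrow> (real \<Rightarrow>\<^sub>C (real ^ 'm))"
  where "\<eta> > 0" "c > 0" "\<Lambda> > 0" "linear G"
    "\<And>k. rev_time (G k) = G k"
    "\<And>k t. rev_time k = - k \<Longrightarrow> (apply_bcontfun (G k) has_vector_derivative A *v apply_bcontfun (G k) t + apply_bcontfun k t) (at t)"
    "\<And>k \<omega> t. slowly_varying \<eta> \<omega> \<Longrightarrow> (\<And>s. \<omega> (- s) = \<omega> s) \<Longrightarrow> (\<And>s. norm (apply_bcontfun k s) \<le> \<omega> s) \<Longrightarrow>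
      norm (apply_bcontfun (G k) t) \<le> c * \<omega> t"
    "\<And>k s t. norm (apply_bcontfun (G k) s - apply_bcontfun (G k) t) \<le> \<Lambda> * norm k * \<bar>s - t\<bar>"
proof -
  obtain \<eta> c and H :: "(real \<Rightarrow>\<^sub>C (real ^ 'm)) \<Rightarrow> (real \<Rightarrow>\<^sub>C (real ^ 'm))"
    where \<eta>: "\<eta> > 0" and c: "c \<ge> 0" and H: "linear H"
    "\<And>k t. (apply_bcontfun (H k) has_vector_derivative A *v apply_bcontfun (H k) t + apply_bcontfun k t) (at t)"
    "\<And>k \<omega> t. slowly_varying \<eta> \<omega> \<Longrightarrow> (\<And>s. norm (apply_bcontfun k s) \<le> \<omega> s) \<Longrightarrow> norm (apply_bcontfun (H k) t) \<le> c * \<omega> t"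
    using hyperbolic_solution_operator[OF hyperbolic] by blast
  obtain r where r: "r > 0" "\<And>v. norm (R v) \<le> r * norm v" using linear_bounded_pos[OF R(1)] by blast
  define G where "G = (\<lambda>k. (1/2) *\<^sub>R (H k + rev_time (H k)))"
  have G: "G k t = (1/2) *\<^sub>R (H k t + R (H k (- t)))" for k t
    by (simp add: G_def apply_time_reversal R)
  have norm_R_le: "norm (v + R w) \<le> (1 + r) * b" if "norm v \<le> b" "norm w \<le> b" for v w b
  proof -
    have "norm (R w) \<le> r * b"
      using r(2)[of w] mult_left_mono[OF that(2), of r] r(1) by linarith
    then show ?thesis using norm_triangle_ineq[of v "R w"] that(1) by (simp add: distrib_right)
  qed
  obtain N where "N > 0" and N: "\<And>v. norm (A *v v) \<le> N * norm v"
    using linear_bounded_pos[OF matrix_vector_mul_linear] by blast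
  have norm_H: "norm (H k t) \<le> c * norm k" for k t
    using H(3)[OF slowly_varying_const[of \<eta> "norm k"]] \<eta> norm_bounded[of k] by simp
  have lipschitz: "norm (H k s - H k t) \<le> (N * c + 1) * norm k * \<bar>s - t\<bar>" for k s t
    unfolding real_norm_def[symmetric]
  proof (rule differentiable_bound[OF convex_UNIV])
    fix x
    show "(H k has_derivative (\<lambda>h. h *\<^sub>R (A *v H k x + k x))) (at x within UNIV)"
      using H(2)[of k x] by (simp add: has_vector_derivative_def)
    show "onorm (\<lambda>h. h *\<^sub>R (A *v H k x + k x)) \<le> (N * c + 1) * norm k"
    proof (rule onorm_bound)
      show "0 \<le> (N * c + 1) * norm k" using \<open>N > 0\<close> c by simp
      have "norm (A *v H k x + k x) \<le> N * (c * norm k) + norm k"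
        using norm_triangle_ineq[of "A *v H k x" "k x"] N[of "H k x"] mult_left_mono[OF norm_H[of k x], of N]
          norm_bounded[of k x] \<open>N > 0\<close> by linarith
      from mult_left_mono[OF this abs_ge_zero]
      show "norm (h *\<^sub>R (A *v H k x + k x)) \<le> (N * c + 1) * norm k * norm h" for h
        by (simp add: ring_distribs mult_ac)
    qed
  qed auto
  show thesis
  proof (rule that[of \<eta> "(1 + r) * (c + 1)" "(1 + r) * (N * c + 1)" G])
    show "\<eta> > 0" by (fact \<eta>)
    show "(1 + r) * (c + 1) > 0" using r c by (intro mult_pos_pos) auto
    show "(1 + r) * (N * c + 1) > 0"
      using r c by (intro mult_pos_pos add_nonneg_pos mult_nonneg_nonneg) (auto simp: \<open>N > 0\<close> less_imp_le)
    show "linear G"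
      unfolding G_def
      by (intro linearI) (simp_all add: linear_add[OF H(1)] linear_cmul[OF H(1)] linear_add[OF linear_time_reversal[OF R(1)]]
        linear_cmul[OF linear_time_reversal[OF R(1)]] scaleR_add_right)
    show "rev_time (G k) = G k" for k
      unfolding G_def by (simp add: linear_add[OF linear_time_reversal[OF R(1)]]
        linear_cmul[OF linear_time_reversal[OF R(1)]] rev_time_involution add.commute)
    show "(apply_bcontfun (G k) has_vector_derivative A *v apply_bcontfun (G k) t + apply_bcontfun k t) (at t)" if "rev_time k = - k" for k t
    proof -
      have k: "R (k (- t)) = - k t"
        using arg_cong[OF that, of "\<lambda>u. apply_bcontfun u t"] by (simp add: apply_time_reversal R)
      have "((\<lambda>t. (1/2) *\<^sub>R (H k t + R (H k (- t)))) has_vector_derivative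
          (1/2) *\<^sub>R ((A *v H k t + k t) + (A *v R (H k (- t)) - R (k (- t))))) (at t)"
        by (intro has_vector_derivative_linear[OF linear_scale_self] has_vector_derivative_add H(2) reversed_solution)
      moreover have "(1/2) *\<^sub>R ((A *v H k t + k t) + (A *v R (H k (- t)) - R (k (- t)))) = A *v G k t + k t"
      proof -
        have "(1/2) *\<^sub>R ((A *v H k t + k t) + (A *v R (H k (- t)) - - k t))
            = (1/2) *\<^sub>R (A *v H k t + A *v R (H k (- t))) + (1/2) *\<^sub>R (k t + k t)"
          by (simp only: scaleR_add_right diff_minus_eq_add add_ac)
        then show ?thesis
          unfolding G k scaleR_half_double
          by (simp add: linear_cmul[OF matrix_vector_mul_linear] matrix_vector_right_distrib)
      qed
      moreover have "(\<lambda>t. (1/2) *\<^sub>R (H k t + R (H k (- t)))) = G k" by (simp add: fun_eq_iff G)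
      ultimately show ?thesis by simp
    qed
    show "norm (G k t) \<le> (1 + r) * (c + 1) * \<omega> t"
      if "slowly_varying \<eta> \<omega>" "\<And>s. \<omega> (- s) = \<omega> s" "\<And>s. norm (apply_bcontfun k s) \<le> \<omega> s" for k \<omega> t
    proof -
      have le: "norm (H k t + R (H k (- t))) \<le> (1 + r) * (c * \<omega> t)"
        using H(3)[OF that(1,3)] that(2) by (intro norm_R_le) (auto, metis)
      have nonneg: "\<omega> t \<ge> 0" using that(3)[of t] norm_ge_zero order_trans by blast
      show ?thesis
      proof -
        have "norm (G k t) = norm (H k t + R (H k (- t))) / 2" unfolding G by simp
        also have "\<dots> \<le> (1 + r) * (c * \<omega> t)"
          using le norm_ge_zero[of "H k t + R (H k (- t))"] by linarith
        also have "\<dots> \<le> (1 + r) * ((c + 1) * \<omega> t)"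
          using r(1) nonneg by (intro mult_left_mono mult_right_mono) auto
        finally show ?thesis by (simp add: mult.assoc)
      qed
    qed
    show "norm (G k s - G k t) \<le> (1 + r) * (N * c + 1) * norm k * \<bar>s - t\<bar>" for k s t
    proof -
      have "norm ((H k s - H k t) + R (H k (- s) - H k (- t))) \<le> (1 + r) * ((N * c + 1) * norm k * \<bar>s - t\<bar>)"
        using lipschitz[of k s t] lipschitz[of k "- s" "- t"]
        by (intro norm_R_le) (simp_all add: abs_minus_commute)
      moreover have "G k s - G k t = (1/2) *\<^sub>R ((H k s - H k t) + R (H k (- s) - H k (- t)))"
        unfolding G by (simp add: linear_diff[OF R(1)] algebra_simps)
      ultimately have "norm (G k s - G k t) \<le> (1/2) * ((1 + r) * ((N * c + 1) * norm k * \<bar>s - t\<bar>))"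
        by simp
      also have "\<dots> \<le> (1 + r) * ((N * c + 1) * norm k * \<bar>s - t\<bar>)"
      proof -
        have "0 \<le> (1 + r) * ((N * c + 1) * norm k * \<bar>s - t\<bar>)"
          using r(1) c \<open>N > 0\<close> by (intro mult_nonneg_nonneg) auto
        then show ?thesis by linarith
      qed
      finally show ?thesis by (simp add: mult.assoc)
    qed
  qed
qed


definition symmetric_solution_of :: "(real \<Rightarrow>\<^sub>C (real ^ 'm)) \<Rightarrow> (real \<Rightarrow>\<^sub>C (real ^ 'm)) \<Rightarrow> bool" where
  "symmetric_solution_of h z \<longleftrightarrow> rev_time z = z \<and>
     (\<forall>t. (apply_bcontfun z has_vector_derivative A *v z t + B t *v z t + h t) (at t))"

lemma symmetric_solution_of_diff:
  assumes "symmetric_solution_of h z" "symmetric_solution_of h' z'"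
  shows "symmetric_solution_of (h - h') (z - z')"
proof -
  have deriv: "((\<lambda>t. z t - z' t) has_vector_derivative
      (A *v z t + B t *v z t + h t) - (A *v z' t + B t *v z' t + h' t)) (at t)" for t
    using assms by (intro has_vector_derivative_diff) (auto simp: symmetric_solution_of_def)
  have rhs: "(A *v z t + B t *v z t + h t) - (A *v z' t + B t *v z' t + h' t)
      = A *v (z - z') t + B t *v (z - z') t + (h - h') t" for t
    by (simp add: matrix_vector_mult_diff_distrib)
  have lhs: "(\<lambda>t. z t - z' t) = apply_bcontfun (z - z')" by (simp add: fun_eq_iff)
  have "rev_time (z - z') = z - z'"
    using assms by (simp add: symmetric_solution_of_def linear_diff[OF linear_time_reversal[OF R(1)]])
  then show ?thesis
    using deriv unfolding rhs lhs symmetric_solution_of_def by blast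
qed

text \<open>
  The equation is \<open>z = K z + G h\<close> with \<open>K z = G (B z)\<close>. The operator \<open>K\<close> is compact, and the proof
  exhibits its finite-rank approximation: sample \<open>K z\<close> at finitely many points and interpolate with
  a partition of unity. On the region covered by the sample points the error is an oscillation of
  \<open>K z\<close> over a short distance, controlled by a Lipschitz bound; elsewhere \<open>K z\<close> itself is small
  because \<open>B\<close> is. Injectivity of \<open>1 - K\<close> is the hypothesis, as fixed points of \<open>K\<close> are
  automatically symmetric.
\<close>
proposition bounded_symmetric_solution:
  assumes nondegenerate: "\<And>z. symmetric_solution_of 0 z \<Longrightarrow> z = 0"
  obtains C where "C \<ge> 0"
    "\<And>h. rev_time h = - h \<Longrightarrow> (apply_bcontfun h \<longlongrightarrow> 0) at_infinity \<Longrightarrow>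
      \<exists>z. symmetric_solution_of h z \<and> (apply_bcontfun z \<longlongrightarrow> 0) at_infinity"
    "\<And>h z. rev_time h = - h \<Longrightarrow> symmetric_solution_of h z \<Longrightarrow> norm z \<le> C * norm h"
proof -
  obtain \<eta> c \<Lambda> and G :: "(real \<Rightarrow>\<^sub>C (real ^ 'm)) \<Rightarrow> (real \<Rightarrow>\<^sub>C (real ^ 'm))"
  where pos: "\<eta> > 0" "c > 0" "\<Lambda> > 0" and G: "linear G"
    "\<And>k. rev_time (G k) = G k"
    "\<And>k t. rev_time k = - k \<Longrightarrow> (apply_bcontfun (G k) has_vector_derivative A *v apply_bcontfun (G k) t + apply_bcontfun k t) (at t)"
    and G_bound: "\<And>k \<omega> t. slowly_varying \<eta> \<omega> \<Longrightarrow> (\<And>s. \<omega> (- s) = \<omega> s) \<Longrightarrow> (\<And>s. norm (apply_bcontfun k s) \<le> \<omega> s) \<Longrightarrow>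
      norm (apply_bcontfun (G k) t) \<le> c * \<omega> t"
    and G_lipschitz: "\<And>k s t. norm (apply_bcontfun (G k) s - apply_bcontfun (G k) t) \<le> \<Lambda> * norm k * \<bar>s - t\<bar>"
    using symmetric_solution_operator by blast
  obtain M where "M > 0" and M: "\<And>t. norm (B t) \<le> M" using bounded_B by blast
  have G_norm: "norm (G k) \<le> c * norm k" for k
    using G_bound[OF slowly_varying_const[of \<eta> "norm k"]] pos norm_bounded[of k] by (intro norm_bound) auto
  have G_vanishes: "(apply_bcontfun (G k) \<longlongrightarrow> 0) at_infinity" if k: "(apply_bcontfun k \<longlongrightarrow> 0) at_infinity" for k
    unfolding Lim_at_infinity
  proof (intro allI impI)
    fix e :: real assume "e > 0"
    define \<epsilon> where "\<epsilon> = e / (4 * c)"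
    have "\<epsilon> > 0" using \<open>e > 0\<close> pos by (simp add: \<epsilon>_def)
    obtain D where "D \<ge> 0" and D: "\<And>t. norm (k t) \<le> \<epsilon> + D * exp (- \<eta> * \<bar>t\<bar>)"
      using vanishing_imp_slowly_varying_bound[OF _ k norm_bounded \<open>\<epsilon> > 0\<close>] pos(1) by (meson less_imp_le)
    obtain T where T: "\<And>t. \<bar>t\<bar> \<ge> T \<Longrightarrow> \<epsilon> + D * exp (- \<eta> * \<bar>t\<bar>) \<le> 2 * \<epsilon>"
      using slowly_varying_bound_small_outside[OF pos(1) \<open>\<epsilon> > 0\<close> \<open>D \<ge> 0\<close>] by blast
    have "norm (G k t) < e" if "\<bar>t\<bar> \<ge> T" for t
    proof -
      have "norm (G k t) \<le> c * (\<epsilon> + D * exp (- \<eta> * \<bar>t\<bar>))"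
        using D \<open>\<epsilon> > 0\<close> \<open>D \<ge> 0\<close> pos by (intro G_bound slowly_varying_exp) auto
      also have "\<dots> \<le> c * (2 * \<epsilon>)" using T[OF that] pos by (intro mult_left_mono) auto
      also have "\<dots> < e" using \<open>e > 0\<close> pos by (simp add: \<epsilon>_def)
      finally show ?thesis .
    qed
    then show "\<exists>b. \<forall>t. b \<le> norm t \<longrightarrow> dist (G k t) 0 < e" by (auto simp: dist_norm)
  qed
  define K where "K = (\<lambda>y. G (perturbation y))"
  have "linear K" using linear_compose[OF linear_perturbation G(1)] by (simp add: K_def o_def)
  have norm_perturbation: "norm (perturbation y) \<le> M * norm y" for y
    using norm_B_mult_le[of _ y] mult_right_mono[OF M norm_ge_zero[of y]]
    by (intro norm_bound) (auto simp: apply_perturbation intro: order_trans)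
  have solution: "symmetric_solution_of h z" if "z = K z + G h" "rev_time h = - h" for h z
  proof -
    (* The range of G consists of symmetric functions, so z is symmetric, and then the source
       B z + h is antisymmetric under time reversal, so that G solves the equation for it. *)
    have z: "z = G (perturbation z + h)" using that(1) by (simp add: K_def linear_add[OF G(1)])
    have sym: "rev_time z = z" by (subst (1 2) z) (rule G(2))
    have "rev_time (perturbation z + h) = - (perturbation z + h)"
      by (simp add: linear_add[OF linear_time_reversal[OF R(1)]] rev_time_perturbation sym that(2))
    from G(3)[OF this] show ?thesis
      unfolding symmetric_solution_of_def z[symmetric] using sym by (simp add: apply_perturbation add.assoc)
  qed
  (* K y is bounded by c |y| times the weight dominating B, and the weight is at most 2 \<epsilon> far out,
     so this \<epsilon> makes K y at most |y| / 2 there. *)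
  define \<epsilon> where "\<epsilon> = 1 / (4 * c)"
  have "\<epsilon> > 0" using pos by (simp add: \<epsilon>_def)
  obtain D where "D \<ge> 0" and D: "\<And>t. norm (B t) \<le> \<epsilon> + D * exp (- \<eta> * \<bar>t\<bar>)"
    using vanishing_imp_slowly_varying_bound[OF _ B(2) M \<open>\<epsilon> > 0\<close>] pos(1) by (meson less_imp_le)
  obtain T where T: "\<And>t. \<bar>t\<bar> \<ge> T \<Longrightarrow> \<epsilon> + D * exp (- \<eta> * \<bar>t\<bar>) \<le> 2 * \<epsilon>"
    using slowly_varying_bound_small_outside[OF pos(1) \<open>\<epsilon> > 0\<close> \<open>D \<ge> 0\<close>] by blast
  have K_tail: "norm (K y t) \<le> norm y / 2" if "\<bar>t\<bar> \<ge> T" for y t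
  proof -
    have "norm (K y t) \<le> c * (norm y * (\<epsilon> + D * exp (- \<eta> * \<bar>t\<bar>)))"
      unfolding K_def
    proof (rule G_bound)
      show "slowly_varying \<eta> (\<lambda>t. norm y * (\<epsilon> + D * exp (- \<eta> * \<bar>t\<bar>)))"
        using \<open>\<epsilon> > 0\<close> \<open>D \<ge> 0\<close> pos by (intro slowly_varying_scaled slowly_varying_exp) auto
      show "norm (perturbation y s) \<le> norm y * (\<epsilon> + D * exp (- \<eta> * \<bar>s\<bar>))" for s
        unfolding apply_perturbation
        using order_trans[OF norm_B_mult_le[of s y] mult_right_mono[OF D[of s] norm_ge_zero[of y]]]
        by (simp only: mult.commute)
    qed simp
    also have "\<dots> \<le> c * (norm y * (2 * \<epsilon>))"
      using T[OF that] pos by (intro mult_left_mono) auto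
    also have "\<dots> = norm y / 2" using pos by (simp add: \<epsilon>_def)
    finally show ?thesis .
  qed
  define d where "d = 1 / (2 * \<Lambda> * M)"
  have "d > 0" using pos \<open>M > 0\<close> by (simp add: d_def)
  have K_osc: "norm (K y s - K y t) \<le> norm y / 2" if "\<bar>s - t\<bar> \<le> d" for y s t
  proof -
    have "norm (K y s - K y t) \<le> \<Lambda> * norm (perturbation y) * \<bar>s - t\<bar>"
      unfolding K_def by (rule G_lipschitz)
    also have "\<dots> \<le> \<Lambda> * (M * norm y) * d"
      using pos \<open>M > 0\<close> that norm_perturbation[of y] by (intro mult_mono mult_left_mono) auto
    also have "\<dots> = norm y / 2" using pos \<open>M > 0\<close> by (simp add: d_def)
    finally show ?thesis .
  qed
  obtain S and w :: "real \<Rightarrow> real \<Rightarrow> real" where "finite S"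
    and w: "\<And>s. continuous_on UNIV (w s)" "\<And>s t. 0 \<le> w s t" "\<And>t. (\<Sum>s\<in>S. w s t) \<le> 1"
      "\<And>t. \<bar>t\<bar> \<le> T \<Longrightarrow> (\<Sum>s\<in>S. w s t) = 1" "\<And>s t. w s t \<noteq> 0 \<Longrightarrow> \<bar>t - s\<bar> \<le> d"
    using finite_partition_of_unity_line[OF \<open>d > 0\<close>, of T] by blast
  define \<phi> :: "real \<times> (real ^ 'm) \<Rightarrow> (real \<Rightarrow>\<^sub>C (real ^ 'm))"
    where "\<phi> = (\<lambda>(s, b). if s \<in> S then Bcontfun (\<lambda>t. w s t *\<^sub>R b) else 0)"
  have \<phi>: "\<phi> (s, b) t = w s t *\<^sub>R b" if "s \<in> S" for s b t
  proof -
    have "w s t \<le> 1" for t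
      using member_le_sum[OF that, of "\<lambda>s. w s t"] w(2,3) \<open>finite S\<close> by (meson order_trans)
    then have "norm (w s t *\<^sub>R b) \<le> norm b" for t
      using w(2)[of s t] mult_right_mono[of "w s t" 1 "norm b"] by simp
    then show ?thesis
      using that w(1) by (simp add: \<phi>_def apply_Bcontfun[of _ "norm b"] continuous_on_scaleR)
  qed
  define g where "g = (\<lambda>(s, b :: real ^ 'm) y. K y s \<bullet> b)"
  (* The interpolation error. Its coefficients are the coordinates of the samples K y s. *)
  define E where "E = (\<lambda>y. K y - (\<Sum>i\<in>S \<times> Basis. g i y *\<^sub>R \<phi> i))"
  have lin_g: "linear (g i)" for i
    unfolding g_def by (cases i) (auto intro!: linearI simp: linear_add[OF \<open>linear K\<close>] linear_cmul[OF \<open>linear K\<close>] inner_add_left)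
  have E: "E y t = (1 - (\<Sum>s\<in>S. w s t)) *\<^sub>R K y t + (\<Sum>s\<in>S. w s t *\<^sub>R (K y t - K y s))" for y t
  proof -
    have "(\<Sum>i\<in>S \<times> Basis. g i y *\<^sub>R \<phi> i) t = (\<Sum>s\<in>S. \<Sum>b\<in>Basis. (K y s \<bullet> b) *\<^sub>R (w s t *\<^sub>R b))"
      unfolding apply_bcontfun_sum sum.cartesian_product by (rule sum.cong) (auto simp: g_def \<phi>)
    also have "\<dots> = (\<Sum>s\<in>S. w s t *\<^sub>R (\<Sum>b\<in>Basis. (K y s \<bullet> b) *\<^sub>R b))"
      by (simp add: scaleR_sum_right mult.commute)
    also have "\<dots> = (\<Sum>s\<in>S. w s t *\<^sub>R K y s)" by (simp add: euclidean_representation)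
    finally show ?thesis
      by (simp add: E_def scaleR_left_diff_distrib scaleR_right_diff_distrib sum_subtractf flip: scaleR_sum_left)
  qed
  have E_le: "norm (E y) \<le> 1/2 * norm y" for y
  proof (rule norm_bound)
    fix t
    have "(1 - (\<Sum>s\<in>S. w s t)) * norm (K y t) \<le> (1 - (\<Sum>s\<in>S. w s t)) * (norm y / 2)"
    proof (cases "\<bar>t\<bar> \<le> T")
      case False
      then show ?thesis using w(3)[of t] by (intro mult_left_mono K_tail) auto
    qed (simp add: w(4))
    moreover have "norm (\<Sum>s\<in>S. w s t *\<^sub>R (K y t - K y s)) \<le> (\<Sum>s\<in>S. w s t * (norm y / 2))"
    proof (intro order_trans[OF norm_sum] sum_mono)
      fix s
      show "norm (w s t *\<^sub>R (K y t - K y s)) \<le> w s t * (norm y / 2)"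
        using w(2)[of s t] w(5)[of s t] K_osc[of t s y] by (cases "w s t = 0") (auto intro: mult_left_mono)
    qed
    ultimately have "norm (E y t) \<le> (1 - (\<Sum>s\<in>S. w s t)) * (norm y / 2) + (\<Sum>s\<in>S. w s t * (norm y / 2))"
      unfolding E using w(3)[of t] by (intro order_trans[OF norm_triangle_ineq add_mono]) simp_all
    then show "norm (E y t) \<le> 1/2 * norm y"
      unfolding sum_distrib_right[symmetric] left_diff_distrib by simp
  qed
  have "\<exists>C\<ge>0. \<forall>u. \<exists>x. x = K x + u \<and> norm x \<le> C * norm u"
  proof (rule finite_rank_perturbation_invertible[OF \<open>linear K\<close>])
    show "linear E"
      unfolding E_def
      by (intro linearI) (simp_all add: linear_add[OF \<open>linear K\<close>] linear_cmul[OF \<open>linear K\<close>] linear_add[OF lin_g]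
        linear_cmul[OF lin_g] scaleR_left_distrib sum.distrib scaleR_right_diff_distrib scaleR_sum_right)
    show "finite (S \<times> (Basis :: (real ^ 'm) set))" using \<open>finite S\<close> by simp
    show "K x = E x + (\<Sum>i\<in>S \<times> Basis. g i x *\<^sub>R \<phi> i)" for x by (simp add: E_def)
    show "\<bar>g i x\<bar> \<le> (c * M) * norm x" if elem: "i \<in> S \<times> Basis" for i x
    proof -
      obtain s b where i: "i = (s, b)" "b \<in> Basis" using elem by auto
      have "\<bar>g i x\<bar> \<le> norm (K x s)" unfolding g_def i by (simp add: Basis_le_norm i(2))
      also have "\<dots> \<le> norm (K x)" by (rule norm_bounded)
      also have "\<dots> \<le> c * (M * norm x)"
        unfolding K_def using G_norm[of "perturbation x"] mult_left_mono[OF norm_perturbation[of x], of c] pos by linarith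
      finally show ?thesis by (simp add: mult.assoc)
    qed
    show "norm (E x) \<le> 1/2 * norm x" for x by (rule E_le)
    show "x = 0" if "K x = x" for x
      by (rule nondegenerate, rule solution) (simp_all add: that linear_0[OF G(1)] linear_0[OF linear_time_reversal[OF R(1)]])
  qed (use lin_g in auto)
  then obtain C where "C \<ge> 0" and C: "\<And>u. \<exists>x. x = K x + u \<and> norm x \<le> C * norm u" by blast
  show thesis
  proof (rule that[of "C * c"])
    show "C * c \<ge> 0" using \<open>C \<ge> 0\<close> pos by simp
    fix h assume h: "rev_time h = - h"
    obtain z where z: "z = K z + G h" "norm z \<le> C * norm (G h)" using C by blast
    have sol: "symmetric_solution_of h z" using solution[OF z(1) h] .
    show "\<exists>z. symmetric_solution_of h z \<and> (z \<longlongrightarrow> 0) at_infinity" if "(h \<longlongrightarrow> 0) at_infinity"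
    proof -
      have "((\<lambda>t. perturbation z t + h t) \<longlongrightarrow> 0 + 0) at_infinity"
        by (intro tendsto_add perturbation_vanishes that)
      then have "(G (perturbation z + h) \<longlongrightarrow> 0) at_infinity"
        by (intro G_vanishes) (simp add: plus_bcontfun.rep_eq)
      moreover have "G (perturbation z + h) = z" using z(1) by (simp add: K_def linear_add[OF G(1)])
      ultimately show ?thesis using sol by auto
    qed
    fix z' assume z': "symmetric_solution_of h z'"
    have "z' - z = 0" using symmetric_solution_of_diff[OF z' sol] by (intro nondegenerate) simp
    then have "norm z' \<le> C * norm (G h)" using z(2) by simp
    also have "\<dots> \<le> C * (c * norm h)" using G_norm[of h] \<open>C \<ge> 0\<close> by (rule mult_left_mono)
    finally show "norm z' \<le> C * c * norm h" by (simp add: mult.assoc)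
  qed
qed

end

section \<open>Semilinear perturbations and persistence of the homoclinic orbit\<close>

lemma closed_vanishing_at_infinity:
  "closed {y :: real \<Rightarrow>\<^sub>C 'a::real_normed_vector. (apply_bcontfun y \<longlongrightarrow> 0) at_infinity}"
  unfolding closed_sequential_limits
proof (intro allI impI, elim conjE)
  fix y :: "nat \<Rightarrow> real \<Rightarrow>\<^sub>C 'a" and l
  assume y: "\<forall>n. y n \<in> {y. (apply_bcontfun y \<longlongrightarrow> 0) at_infinity}" and l: "y \<longlonglongrightarrow> l"
  have "(apply_bcontfun l \<longlongrightarrow> 0) at_infinity"
  proof (rule tendstoI)
    fix e :: real assume "e > 0"
    then obtain n where n: "dist (y n) l < e / 2"
      using l[unfolded lim_sequentially, rule_format, of "e / 2"] by auto
    have "\<forall>\<^sub>F t in at_infinity. dist (y n t) 0 < e / 2"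
      using y \<open>e > 0\<close> by (intro tendstoD) auto
    then show "\<forall>\<^sub>F t in at_infinity. dist (l t) 0 < e"
    proof eventually_elim
      case (elim t)
      have "dist (l t) (y n t) \<le> dist l (y n)" by (rule dist_bounded)
      then show ?case using elim n dist_triangle[of "l t" 0 "y n t"] dist_commute[of l "y n"] by linarith
    qed
  qed
  then show "l \<in> {y. (apply_bcontfun y \<longlongrightarrow> 0) at_infinity}" by simp
qed

lemma closed_fixed_points:
  assumes "continuous_on UNIV g"
  shows "closed {y :: 'a::t2_space. g y = y}"
  using closed_Collect_eq[OF assms continuous_on_id] by simp

lemma continuous_on_time_reversal:
  fixes R :: "'a::euclidean_space \<Rightarrow> 'a"
  assumes "linear R"
  shows "continuous_on UNIV (time_reversal R)"
proof -
  obtain r where r: "r > 0" "\<And>v. norm (R v) \<le> r * norm v" using linear_bounded_pos[OF assms] by blast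
  have "norm (time_reversal R u) \<le> norm u * r" for u
  proof (rule norm_bound)
    fix t
    show "norm (time_reversal R u t) \<le> norm u * r"
      unfolding apply_time_reversal[OF assms]
      using r(2)[of "u (- t)"] mult_left_mono[OF norm_bounded[of u "- t"] less_imp_le[OF r(1)]]
      unfolding mult.commute[of "norm u"] by linarith
  qed
  then have "bounded_linear (time_reversal R)"
    using linear_time_reversal[OF assms] by (intro bounded_linear_intro) (auto simp: linear_add linear_cmul)
  then show ?thesis by (rule bounded_linear.continuous_on) (rule continuous_on_id)
qed

text \<open>
  The substitution \<open>y \<mapsto> g(\<cdot>, y(\<cdot>))\<close> turns symmetric functions into sources \<open>h\<close> with
  \<open>h(-t) = -R h(t)\<close>, preserves continuity and decay, and is small on the ball of radius \<open>\<rho>\<close>: \<open>e\<close> is a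
  Lipschitz constant there, and the bound \<open>e \<rho>\<close> at \<open>v = 0\<close> is what keeps the ball invariant in a
  contraction argument.
\<close>
definition (in reversible_linear_system) small_nonlinearity ::
  "real \<Rightarrow> real \<Rightarrow> (real \<Rightarrow> real ^ 'm \<Rightarrow> real ^ 'm) \<Rightarrow> bool" where
  "small_nonlinearity e \<rho> g \<longleftrightarrow>
     (\<forall>t v. g (- t) (R v) = - R (g t v)) \<and>
     (\<forall>y. continuous_on UNIV y \<longrightarrow> continuous_on UNIV (\<lambda>t. g t (y t))) \<and>
     (\<forall>y. (y \<longlongrightarrow> 0) at_infinity \<longrightarrow> ((\<lambda>t. g t (y t)) \<longlongrightarrow> 0) at_infinity) \<and>
     (\<forall>t v w. norm v \<le> \<rho> \<longrightarrow> norm w \<le> \<rho> \<longrightarrow> norm (g t v - g t w) \<le> e * norm (v - w)) \<and>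
     (\<forall>t. norm (g t 0) \<le> e * \<rho>)"

text \<open>
  The bound \<open>C\<close> of the linear problem determines \<open>e\<close>: with \<open>C e < 1/2\<close>, solving the linear problem
  with source \<open>g(\<cdot>, y(\<cdot>))\<close> is a contraction of the ball of radius \<open>\<rho>\<close> in the closed subspace of
  symmetric functions that vanish at infinity. Decay of the solution is thus built into the space on
  which the contraction acts.
\<close>
proposition (in reversible_linear_system) semilinear_symmetric_solution:
  assumes nondegenerate: "\<And>z. symmetric_solution_of 0 z \<Longrightarrow> z = 0"
  shows "\<exists>e>0. \<forall>\<rho>>0. \<forall>g. small_nonlinearity e \<rho> g \<longrightarrow>
      (\<exists>y. norm y \<le> \<rho> \<and> rev_time y = y \<and> (apply_bcontfun y \<longlongrightarrow> 0) at_infinity \<and>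
        (\<forall>t. (apply_bcontfun y has_vector_derivative A *v y t + B t *v y t + g t (y t)) (at t)))"
proof -
  obtain C where "C \<ge> 0"
    and solvable: "\<And>h. rev_time h = - h \<Longrightarrow> (apply_bcontfun h \<longlongrightarrow> 0) at_infinity \<Longrightarrow>
      \<exists>z. symmetric_solution_of h z \<and> (apply_bcontfun z \<longlongrightarrow> 0) at_infinity"
    and C: "\<And>h z. rev_time h = - h \<Longrightarrow> symmetric_solution_of h z \<Longrightarrow> norm z \<le> C * norm h"
    using bounded_symmetric_solution[OF nondegenerate] by blast
  define e where "e = 1 / (2 * (C + 1))"
  have "e > 0" "C * e < 1 / 2" using \<open>C \<ge> 0\<close> by (simp_all add: e_def field_simps)
  have "\<exists>y. norm y \<le> \<rho> \<and> rev_time y = y \<and> (apply_bcontfun y \<longlongrightarrow> 0) at_infinity \<and>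
      (\<forall>t. (apply_bcontfun y has_vector_derivative A *v y t + B t *v y t + g t (y t)) (at t))"
    if \<rho>: "\<rho> > 0" and small: "small_nonlinearity e \<rho> g" for \<rho> g
  proof -
    have g_R: "g (- t) (R v) = - R (g t v)"
      and g_cont: "continuous_on UNIV y \<Longrightarrow> continuous_on UNIV (\<lambda>t. g t (y t))"
      and g_lim: "(y \<longlongrightarrow> 0) at_infinity \<Longrightarrow> ((\<lambda>t. g t (y t)) \<longlongrightarrow> 0) at_infinity"
      and g_lip: "norm v \<le> \<rho> \<Longrightarrow> norm w \<le> \<rho> \<Longrightarrow> norm (g t v - g t w) \<le> e * norm (v - w)"
      and g0: "norm (g t 0) \<le> e * \<rho>" for t v w y
      using small unfolding small_nonlinearity_def by blast+
    have g_le: "norm (g t v) \<le> 2 * e * \<rho>" if "norm v \<le> \<rho>" for t v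
    proof -
      have "norm (g t v - g t 0) \<le> e * norm v" using g_lip[of v 0 t] that \<rho> by simp
      also have "\<dots> \<le> e * \<rho>" using that \<open>e > 0\<close> by simp
      finally show ?thesis using g0[of t] norm_triangle_sub[of "g t v" "g t 0"] by simp
    qed
    define X where "X = {y :: real \<Rightarrow>\<^sub>C (real ^ 'm). norm y \<le> \<rho>} \<inter> {y. rev_time y = y} \<inter> {y. (apply_bcontfun y \<longlongrightarrow> 0) at_infinity}"
    define N where "N = (\<lambda>y :: real \<Rightarrow>\<^sub>C (real ^ 'm). Bcontfun (\<lambda>t. g t (y t)))"
    have X_le: "norm (y t) \<le> \<rho>" if "y \<in> X" for y t
      using that norm_bounded[of y t] by (simp add: X_def)
    have N: "N y t = g t (y t)" if "y \<in> X" for y t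
      unfolding N_def using g_cont[OF continuous_on_apply_bcontfun] g_le[OF X_le[OF that]] by (subst apply_Bcontfun) auto
    have N_le: "norm (N y) \<le> 2 * e * \<rho>" if "y \<in> X" for y
      using g_le[OF X_le[OF that]] N[OF that] by (intro norm_bound) simp
    have N_diff: "norm (N y - N y') \<le> e * norm (y - y')" if "y \<in> X" "y' \<in> X" for y y'
    proof (rule norm_bound)
      fix t
      have "norm (g t (y t) - g t (y' t)) \<le> e * norm (y t - y' t)"
        by (rule g_lip[OF X_le[OF that(1)] X_le[OF that(2)]])
      also have "\<dots> \<le> e * norm (y - y')" using norm_bounded[of "y - y'" t] \<open>e > 0\<close> by simp
      finally show "norm ((N y - N y') t) \<le> e * norm (y - y')" by (simp add: N that)
    qed
    have N_rev: "rev_time (N y) = - N y" if "y \<in> X" for y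
    proof (rule bcontfun_eqI)
      fix t
      have "rev_time y (- t) = y (- t)" using that by (simp add: X_def)
      then have "R (y t) = y (- t)" by (simp add: apply_time_reversal R(1))
      then show "rev_time (N y) t = (- N y) t"
        using g_R[of t "y t"] by (simp add: apply_time_reversal R N[OF that] linear_neg[OF R(1)])
    qed
    have N_lim: "(N y \<longlongrightarrow> 0) at_infinity" if "y \<in> X" for y
    proof -
      have "apply_bcontfun (N y) = (\<lambda>t. g t (y t))" using N[OF that] by auto
      then show ?thesis using g_lim[of "apply_bcontfun y"] that by (simp add: X_def)
    qed
    have "\<forall>y. \<exists>z. y \<in> X \<longrightarrow> symmetric_solution_of (N y) z \<and> (apply_bcontfun z \<longlongrightarrow> 0) at_infinity"
      using solvable N_rev N_lim by blast
    then obtain \<Psi> where \<Psi>: "\<And>y. y \<in> X \<Longrightarrow> symmetric_solution_of (N y) (\<Psi> y)"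
      "\<And>y. y \<in> X \<Longrightarrow> (apply_bcontfun (\<Psi> y) \<longlongrightarrow> 0) at_infinity"
      unfolding choice_iff by blast
    have "\<exists>!y\<in>X. \<Psi> y = y"
    proof (rule Banach_fix)
      have "closed {y :: real \<Rightarrow>\<^sub>C (real ^ 'm). norm y \<le> \<rho>}"
        by (intro closed_Collect_le continuous_intros)
      then have "closed X" unfolding X_def
        by (intro closed_Int closed_fixed_points continuous_on_time_reversal R(1) closed_vanishing_at_infinity)
      then show "complete X" by (simp add: complete_eq_closed)
      have "0 \<in> X" using \<rho> linear_0[OF linear_time_reversal[OF R(1)]] by (simp add: X_def zero_bcontfun.rep_eq)
      then show "X \<noteq> {}" by blast
      show "0 \<le> (1/2 :: real)" "(1/2 :: real) < 1" by auto
      show "\<Psi> ` X \<subseteq> X"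
      proof (rule image_subsetI)
        fix y assume y: "y \<in> X"
        have "norm (\<Psi> y) \<le> C * norm (N y)" by (rule C[OF N_rev[OF y] \<Psi>(1)[OF y]])
        also have "\<dots> \<le> C * (2 * e * \<rho>)" using N_le[OF y] \<open>C \<ge> 0\<close> by (rule mult_left_mono)
        also have "\<dots> = (C * e) * (2 * \<rho>)" by simp
        also have "\<dots> \<le> 1 / 2 * (2 * \<rho>)" using \<open>C * e < 1 / 2\<close> \<rho> by (intro mult_right_mono) auto
        finally show "\<Psi> y \<in> X" using \<Psi>[OF y] by (simp add: X_def symmetric_solution_of_def)
      qed
      show "dist (\<Psi> y) (\<Psi> y') \<le> 1/2 * dist y y'" if y: "y \<in> X" "y' \<in> X" for y y'
      proof -
        have "rev_time (N y - N y') = - (N y - N y')"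
          by (simp add: linear_diff[OF linear_time_reversal[OF R(1)]] N_rev y)
        from C[OF this symmetric_solution_of_diff[OF \<Psi>(1) \<Psi>(1)]] y
        have "norm (\<Psi> y - \<Psi> y') \<le> C * norm (N y - N y')" by blast
        also have "\<dots> \<le> C * (e * norm (y - y'))" using N_diff[OF y] \<open>C \<ge> 0\<close> by (rule mult_left_mono)
        also have "\<dots> = (C * e) * norm (y - y')" by simp
        also have "\<dots> \<le> 1/2 * norm (y - y')" using \<open>C * e < 1 / 2\<close> by (intro mult_right_mono) auto
        finally show ?thesis by (simp add: dist_norm)
      qed
    qed
    then obtain y where y: "y \<in> X" "\<Psi> y = y" by blast
    have sol: "symmetric_solution_of (N y) y" using \<Psi>(1)[OF y(1)] y(2) by simp
    moreover have "norm y \<le> \<rho>" "rev_time y = y" "(apply_bcontfun y \<longlongrightarrow> 0) at_infinity"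
      using y(1) by (simp_all add: X_def)
    ultimately show ?thesis
      unfolding symmetric_solution_of_def N[OF y(1)] by blast
  qed
  then show ?thesis using \<open>e > 0\<close> by blast
qed

theorem theorem3p4:
  fixes f :: "real ^ 'm \<Rightarrow> real \<Rightarrow> real ^ 'm"
    and R :: "real ^ 'm \<Rightarrow> real ^ 'm"
    and x\<^sub>h :: "real \<Rightarrow> real ^ 'm"
    and ev :: "nat \<Rightarrow> complex"
    and n :: nat
  assumes dimension: "CARD('m) = 2 * n" "n \<ge> 2"
    and analytic: "\<And>x \<mu>. real_analytic_at (\<lambda>(x, \<mu>). f x \<mu>) (x, \<mu>)"
    and R1: "linear R" "\<And>x. R (R x) = x" "\<And>x \<mu>. f (R x) \<mu> + R (f x \<mu>) = 0"
      "dim (fixed_space R) = n"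
    and R2: "\<And>\<mu>. f 0 \<mu> = 0"
    and R3: "eigenvalues (jacobian (\<lambda>x. f x 0) (at 0)) =
        image_mset ev (mset_set {1..n}) + image_mset (\<lambda>i. - ev i) (mset_set {1..n})"
      "0 < Re (ev 1)"
      "\<And>i j. 1 \<le> i \<Longrightarrow> i \<le> j \<Longrightarrow> j \<le> n \<Longrightarrow> Re (ev i) \<le> Re (ev j)"
    and R4: "homoclinic_to_origin (\<lambda>x. f x 0) x\<^sub>h" "symmetric_solution R x\<^sub>h"
      "x\<^sub>h 0 \<in> fixed_space R"
    and R5: "\<not> (\<exists>\<xi>. variational_solution (\<lambda>x. f x 0) x\<^sub>h \<xi> \<and> bounded (range \<xi>) \<and>
        lin_indep_functions \<xi> (\<lambda>t. vector_derivative x\<^sub>h (at t)))"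
  shows "\<exists>I :: real set. open I \<and> is_interval I \<and> 0 \<in> I \<and>
    (\<forall>\<mu>\<in>I. \<exists>x. homoclinic_to_origin (\<lambda>y. f y \<mu>) x \<and> symmetric_solution R x)"
proof -
  let ?F = "\<lambda>(x, \<mu>). f x \<mu>"
  have "\<forall>p. \<exists>L. strict_derivative_at ?F L p"
    using real_analytic_strict_derivative[OF analytic] by (metis surj_pair)
  then obtain D where D: "\<And>p. strict_derivative_at ?F (D p) p" unfolding choice_iff by blast
  define J where "J = (\<lambda>x. jacobian (\<lambda>x. f x 0) (at x))"
  have D_deriv: "((\<lambda>x. f x 0) has_derivative (\<lambda>v. D (x, 0) (v, 0))) (at x)" for x
  proof -
    have "((\<lambda>x. (x, 0 :: real)) has_derivative (\<lambda>v. (v, 0))) (at x)"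
      by (intro has_derivative_Pair has_derivative_ident has_derivative_const)
    from has_derivative_compose[OF this strict_derivative_has_derivative[OF D]]
    show ?thesis by simp
  qed
  then have J_deriv: "((\<lambda>x. f x 0) has_derivative (\<lambda>v. J x *v v)) (at x)" for x
    unfolding J_def by (metis differentiableI jacobian_works)
  have J: "J x *v v = D (x, 0) (v, 0)" for x v
    using fun_cong[OF has_derivative_unique[OF J_deriv D_deriv], of x v] by simp
  have J_cont: "continuous_on UNIV J"
  proof -
    have "continuous_on UNIV (\<lambda>x. \<chi> i j. D (x, 0) (axis j 1, 0) $ i)"
      by (intro continuous_intros continuous_on_compose2[OF strict_derivative_continuous[OF D]]) auto
    moreover have "(\<chi> i j. D (x, 0) (axis j 1, 0) $ i) = J x" for x
      by (simp add: vec_eq_iff flip: J) (simp add: matrix_vector_mul_component inner_axis)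
    ultimately show ?thesis by simp
  qed
  have f_cont: "continuous_on UNIV ?F"
    by (intro continuous_at_imp_continuous_on ballI has_derivative_continuous[OF strict_derivative_has_derivative[OF D]])
  have xh: "(x\<^sub>h has_vector_derivative f (x\<^sub>h t) 0) (at t)" for t
    using R4(1) by (simp add: homoclinic_to_origin_def solves_on_line_def)
  have xh_cont: "continuous_on UNIV x\<^sub>h" by (rule differentiable_continuous_on[OF xh])
  have xh_lim: "(x\<^sub>h \<longlongrightarrow> 0) at_infinity"
    using R4(1) unfolding homoclinic_to_origin_def at_infinity_eq_at_top_bot by (intro filterlim_sup) auto
  have xh_sym: "R (x\<^sub>h (- t)) = x\<^sub>h t" for t
    using R4(2) unfolding symmetric_solution_def by metis
  have xh_neg: "x\<^sub>h (- t) = R (x\<^sub>h t)" for t using xh_sym[of "- t"] by simp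
  obtain t\<^sub>0 where t0: "x\<^sub>h t\<^sub>0 \<noteq> 0" using R4(1) by (auto simp: homoclinic_to_origin_def)
  have f_R: "f (R x) \<mu> = - R (f x \<mu>)" for x \<mu> using R1(3) by (simp add: eq_neg_iff_add_eq_0)
  have R_bounded: "bounded_linear R" using R1(1) by (simp add: linear_conv_bounded_linear)
  (* Differentiate the reversibility relation f (R x) = - R (f x). *)
  have J_R: "J (R x) *v R v = - R (J x *v v)" for x v
  proof -
    have "((\<lambda>x. f (R x) 0) has_derivative (\<lambda>v. J (R x) *v R v)) (at x)"
      by (rule has_derivative_compose[OF linear_imp_has_derivative[OF R1(1)] J_deriv])
    moreover have "((\<lambda>x. - R (f x 0)) has_derivative (\<lambda>v. - R (J x *v v))) (at x)"
      by (intro has_derivative_minus bounded_linear.has_derivative[OF R_bounded J_deriv])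
    ultimately have "(\<lambda>v. J (R x) *v R v) = (\<lambda>v. - R (J x *v v))"
      unfolding f_R by (rule has_derivative_unique)
    then show ?thesis by (rule fun_cong)
  qed
  have R0: "R 0 = 0" using R1(1) by (rule linear_0)
  define B where "B = (\<lambda>t. J (x\<^sub>h t) - J 0)"
  interpret reversible_linear_system "J 0" B R
  proof (rule reversible_linear_system.intro)
    show "eigenvalues (J 0) \<noteq> {#}"
      unfolding J_def R3(1) using dimension(2) by (simp add: mset_set_empty_iff)
    show "Re l \<noteq> 0" if "l \<in># eigenvalues (J 0)" for l
    proof -
      have "Re (ev i) > 0" if "1 \<le> i" "i \<le> n" for i
        using R3(2) R3(3)[of 1 i] that by auto
      then show ?thesis using that unfolding J_def R3(1) by fastforce
    qed
    show "continuous_on UNIV B"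
      unfolding B_def by (intro continuous_intros continuous_on_compose2[OF J_cont xh_cont]) auto
    have "((\<lambda>t. J (x\<^sub>h t)) \<longlongrightarrow> J 0) at_infinity"
      using J_cont xh_lim by (intro isCont_tendsto_compose[of 0 J]) (simp_all add: continuous_on_eq_continuous_at)
    then show "(B \<longlongrightarrow> 0) at_infinity" unfolding B_def by (simp add: LIM_zero_iff)
    show "J 0 *v R v = - R (J 0 *v v)" for v using J_R[of 0 v] R0 by simp
    show "B (- t) *v R v = - R (B t *v v)" for t v
      unfolding B_def using J_R[of 0 v] J_R[of "x\<^sub>h t" v] R0
      by (simp add: matrix_vector_mult_diff_rdistrib linear_diff[OF R1(1)] xh_neg)
  qed (rule R1(1,2))+
  have AB: "J 0 *v v + B t *v v = J (x\<^sub>h t) *v v" for t v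
    by (simp add: B_def matrix_vector_mult_diff_rdistrib)
  (* A nonzero symmetric z would be independent of the antisymmetric function x\<^sub>h': adding and
     subtracting a relation a z + b x\<^sub>h' = 0 and its time reversal gives a z = 0 and b x\<^sub>h' = 0. *)
  have nondegenerate: "z = 0" if z: "symmetric_solution_of 0 z" for z
  proof (rule ccontr)
    assume "z \<noteq> 0"
    then obtain s where s: "z s \<noteq> 0" by (metis bcontfun_eqI zero_bcontfun.rep_eq)
    have z_sym: "R (z (- t)) = z t" for t
    proof -
      have "rev_time z t = z t" using z by (simp add: symmetric_solution_of_def)
      then show ?thesis by (simp add: apply_time_reversal R1(1))
    qed
    have vd: "vector_derivative x\<^sub>h (at t) = f (x\<^sub>h t) 0" for t
      by (rule vector_derivative_at[OF xh])
    have "\<exists>t. f (x\<^sub>h t) 0 \<noteq> 0"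
    proof (rule ccontr)
      assume "\<nexists>t. f (x\<^sub>h t) 0 \<noteq> 0"
      then have "(x\<^sub>h has_vector_derivative 0) (at t)" for t using xh[of t] by simp
      then obtain c where c: "\<And>t. x\<^sub>h t = c" using has_vector_derivative_zero_constant[of UNIV x\<^sub>h] by auto
      then have "x\<^sub>h = (\<lambda>t. c)" by auto
      then have "((\<lambda>t :: real. c) \<longlongrightarrow> 0) at_top" using R4(1) by (simp add: homoclinic_to_origin_def)
      then have "c = 0" by (simp add: tendsto_const_iff)
      then show False using c t0 by simp
    qed
    then obtain t1 where t1: "f (x\<^sub>h t1) 0 \<noteq> 0" by blast
    have "lin_indep_functions z (\<lambda>t. vector_derivative x\<^sub>h (at t))"
      unfolding lin_indep_functions_def vd
    proof (intro allI impI)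
      fix a b assume ab: "\<forall>t. a *\<^sub>R z t + b *\<^sub>R f (x\<^sub>h t) 0 = 0"
      have "a *\<^sub>R z t - b *\<^sub>R f (x\<^sub>h t) 0 = 0" for t
      proof -
        have "R (a *\<^sub>R z (- t) + b *\<^sub>R f (x\<^sub>h (- t)) 0) = R 0" using ab by simp
        then show ?thesis
          by (simp add: linear_add[OF R1(1)] linear_cmul[OF R1(1)] linear_neg[OF R1(1)] linear_diff[OF R1(1)]
            z_sym xh_neg f_R R1(2) R0)
      qed
      then have eq: "a *\<^sub>R z t = b *\<^sub>R f (x\<^sub>h t) 0" for t by simp
      then have "b *\<^sub>R f (x\<^sub>h t) 0 + b *\<^sub>R f (x\<^sub>h t) 0 = 0" for t using ab by metis
      then have b0: "b *\<^sub>R f (x\<^sub>h t) 0 = 0" for t by (metis scaleR_half_double scaleR_zero_right)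
      then have "a *\<^sub>R z t = 0" for t using eq by simp
      from this[of s] b0[of t1] show "a = 0 \<and> b = 0" using s t1 by auto
    qed
    moreover have "variational_solution (\<lambda>x. f x 0) x\<^sub>h z"
      using z AB unfolding variational_solution_def solves_on_line_def symmetric_solution_of_def
      by (simp add: J_def)
    ultimately show False using R5 bounded_apply_bcontfun by blast
  qed
  obtain e where "e > 0" and semilinear: "\<And>\<rho> g. \<rho> > 0 \<Longrightarrow> small_nonlinearity e \<rho> g \<Longrightarrow>
      \<exists>y. norm y \<le> \<rho> \<and> rev_time y = y \<and> (apply_bcontfun y \<longlongrightarrow> 0) at_infinity \<and>
        (\<forall>t. (apply_bcontfun y has_vector_derivative J 0 *v y t + B t *v y t + g t (y t)) (at t))"
    using semilinear_symmetric_solution[OF nondegenerate] by blast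
  (* Compactness of the orbit closure makes the smallness of the remainder uniform in time. *)
  define S where "S = closure (range x\<^sub>h)"
  obtain M where "\<And>t. norm (x\<^sub>h t) \<le> M"
    using continuous_vanishing_imp_bounded[OF xh_cont xh_lim] by blast
  then have "compact S" unfolding S_def by (auto simp: bounded_iff)
  have xh_S: "x\<^sub>h t \<in> S" for t using closure_subset by (force simp: S_def)
  have "compact (S \<times> {0::real})" using \<open>compact S\<close> by (intro compact_Times) auto
  from strict_derivative_uniform[OF D this \<open>e > 0\<close>]
  obtain d where "d > 0" and d: "\<And>a p q. a \<in> S \<Longrightarrow> norm (p - (a, 0)) < d \<Longrightarrow> norm (q - (a, 0)) < d \<Longrightarrow>
      norm (?F p - ?F q - D (a, 0) (p - q)) \<le> e * norm (p - q)" by auto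
  have small: "norm (f (x\<^sub>h t + v) \<mu> - f (x\<^sub>h t + w) \<mu> - J (x\<^sub>h t) *v (v - w)) \<le> e * norm (v - w)"
    if "norm v < d / 2" "norm w < d / 2" "\<bar>\<mu>\<bar> < d / 2" for t v w \<mu>
  proof -
    have "norm ((x\<^sub>h t + u, \<mu>) - (x\<^sub>h t, 0)) < d" if "norm u < d / 2" for u
      using norm_Pair_le[of u \<mu>] that \<open>\<bar>\<mu>\<bar> < d / 2\<close> by simp
    from d[OF xh_S[of t] this[OF that(1)] this[OF that(2)]] show ?thesis
      by (simp add: J norm_Pair)
  qed
  (* The second bound keeps x\<^sub>h + y away from the equilibrium at time t\<^sub>0. *)
  define \<rho> where "\<rho> = min (d / 3) (norm (x\<^sub>h t\<^sub>0) / 2)"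
  have \<rho>: "\<rho> > 0" "\<rho> < d / 2" "\<rho> < norm (x\<^sub>h t\<^sub>0)" using \<open>d > 0\<close> t0 by (auto simp: \<rho>_def min_def)
  have "uniformly_continuous_on (S \<times> {-1..1}) ?F"
    using \<open>compact S\<close> by (intro compact_uniformly_continuous continuous_on_subset[OF f_cont] compact_Times) auto
  then obtain \<delta>' where "\<delta>' > 0" and \<delta>': "\<And>p q. p \<in> S \<times> {-1..1} \<Longrightarrow> q \<in> S \<times> {-1..1} \<Longrightarrow> dist q p < \<delta>' \<Longrightarrow>
      dist (?F q) (?F p) < e * \<rho>"
    unfolding uniformly_continuous_on_def using \<open>e > 0\<close> \<rho>(1) by (metis mult_pos_pos)
  define \<delta> where "\<delta> = min 1 (min \<delta>' (d / 2))"
  have "\<delta> > 0" "\<delta> \<le> 1" "\<delta> \<le> \<delta>'" "\<delta> \<le> d / 2" using \<open>\<delta>' > 0\<close> \<open>d > 0\<close> by (auto simp: \<delta>_def)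
  have f_mu: "norm (f (x\<^sub>h t) \<mu> - f (x\<^sub>h t) 0) \<le> e * \<rho>" if "\<bar>\<mu>\<bar> < \<delta>" for t \<mu>
  proof -
    have "- 1 \<le> \<mu>" "\<mu> \<le> 1" "\<bar>\<mu>\<bar> < \<delta>'" using that \<open>\<delta> \<le> 1\<close> \<open>\<delta> \<le> \<delta>'\<close> by linarith+
    then have "dist (f (x\<^sub>h t) \<mu>) (f (x\<^sub>h t) 0) < e * \<rho>"
      using \<delta>'[of "(x\<^sub>h t, 0)" "(x\<^sub>h t, \<mu>)"] xh_S[of t] by (simp add: dist_Pair_Pair dist_norm)
    then show ?thesis by (simp add: dist_norm)
  qed
  have main: "\<exists>x. homoclinic_to_origin (\<lambda>y. f y \<mu>) x \<and> symmetric_solution R x" if \<mu>: "\<bar>\<mu>\<bar> < \<delta>" for \<mu>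
  proof -
    have \<mu>d: "\<bar>\<mu>\<bar> < d / 2" using \<mu> \<open>\<delta> \<le> d / 2\<close> by simp
    (* The remainder for which y solves the semilinear equation iff x\<^sub>h + y solves the system at \<mu>. *)
    define g where "g = (\<lambda>t v. f (x\<^sub>h t + v) \<mu> - f (x\<^sub>h t) 0 - J (x\<^sub>h t) *v v)"
    have g_lip: "norm (g t v - g t w) \<le> e * norm (v - w)" if "norm v \<le> \<rho>" "norm w \<le> \<rho>" for t v w
      using small[of v w \<mu> t] that \<rho>(2) \<mu>d by (simp add: g_def matrix_vector_mult_diff_distrib algebra_simps)
    have g0: "norm (g t 0) \<le> e * \<rho>" for t using f_mu[OF \<mu>, of t] by (simp add: g_def)
    have g_R: "g (- t) (R v) = - R (g t v)" for t v
      using f_R[of "x\<^sub>h t + v" \<mu>] f_R[of "x\<^sub>h t" 0]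
      by (simp add: g_def xh_neg J_R linear_add[OF R1(1)] linear_diff[OF R1(1)])
    have g_cont: "continuous_on UNIV (\<lambda>t. g t (y t))" if "continuous_on UNIV y" for y
    proof -
      have "continuous_on UNIV (\<lambda>t. ?F (u t, \<nu>))" if "continuous_on UNIV u" for u and \<nu> :: real
        using that by (intro continuous_on_compose2[OF f_cont] continuous_intros) auto
      from this[of "\<lambda>t. x\<^sub>h t + y t" \<mu>] this[of x\<^sub>h 0] show ?thesis
        unfolding g_def matrix_vector_mult_def using that xh_cont
        by (auto intro!: continuous_intros continuous_on_compose2[OF J_cont])
    qed
    have g_lim: "((\<lambda>t. g t (y t)) \<longlongrightarrow> 0) at_infinity" if "(y \<longlongrightarrow> 0) at_infinity" for y
    proof -
      have F_lim: "((\<lambda>t. ?F (u t, \<nu>)) \<longlongrightarrow> ?F (0, \<nu>)) at_infinity" if "(u \<longlongrightarrow> 0) at_infinity" for u and \<nu> :: real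
        using f_cont that by (intro isCont_tendsto_compose[of _ ?F] tendsto_intros) (simp_all add: continuous_on_eq_continuous_at)
      have J_lim: "((\<lambda>t. J (x\<^sub>h t)) \<longlongrightarrow> J 0) at_infinity"
        using J_cont xh_lim by (intro isCont_tendsto_compose[of 0 J]) (simp_all add: continuous_on_eq_continuous_at)
      have "((\<lambda>t. J (x\<^sub>h t) *v y t) \<longlongrightarrow> J 0 *v 0) at_infinity"
        unfolding matrix_vector_mult_def using J_lim that by (intro tendsto_intros)
      moreover have "((\<lambda>t. f (x\<^sub>h t + y t) \<mu>) \<longlongrightarrow> 0) at_infinity"
        using F_lim[of "\<lambda>t. x\<^sub>h t + y t" \<mu>] tendsto_add[OF xh_lim that] by (simp add: R2)
      moreover have "((\<lambda>t. f (x\<^sub>h t) 0) \<longlongrightarrow> 0) at_infinity"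
        using F_lim[of x\<^sub>h 0] xh_lim by (simp add: R2)
      ultimately have "((\<lambda>t. g t (y t)) \<longlongrightarrow> 0 - 0 - J 0 *v 0) at_infinity"
        unfolding g_def by (intro tendsto_diff)
      then show ?thesis by simp
    qed
    have "small_nonlinearity e \<rho> g"
      unfolding small_nonlinearity_def by (intro conjI allI impI g_R g_cont g_lim g_lip g0)
    from semilinear[OF \<rho>(1) this] obtain y where y_le: "norm y \<le> \<rho>" and y_sym: "rev_time y = y"
      and y_lim: "(apply_bcontfun y \<longlongrightarrow> 0) at_infinity"
      and y: "\<And>t. (apply_bcontfun y has_vector_derivative J 0 *v y t + B t *v y t + g t (y t)) (at t)"
      by blast
    define x where "x = (\<lambda>t. x\<^sub>h t + y t)"
    have "(x has_vector_derivative f (x t) \<mu>) (at t)" for t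
    proof -
      have "(y has_vector_derivative J (x\<^sub>h t) *v y t + g t (y t)) (at t)"
        using y[of t] by (simp only: AB)
      from has_vector_derivative_add[OF xh this] show ?thesis by (simp add: x_def g_def)
    qed
    moreover have "x t\<^sub>0 \<noteq> 0"
      using norm_bounded[of y t\<^sub>0] y_le \<rho>(3) unfolding x_def
      by (metis add_eq_0_iff norm_minus_cancel not_less order_trans)
    moreover have "(x \<longlongrightarrow> 0) at_infinity"
      using tendsto_add[OF xh_lim y_lim] by (simp add: x_def)
    then have "(x \<longlongrightarrow> 0) at_top" "(x \<longlongrightarrow> 0) at_bot"
      by (simp_all add: tendsto_mono[OF at_top_le_at_infinity] tendsto_mono[OF at_bot_le_at_infinity])
    ultimately have "homoclinic_to_origin (\<lambda>y. f y \<mu>) x"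
      unfolding homoclinic_to_origin_def solves_on_line_def by blast
    moreover have "symmetric_solution R x"
      unfolding symmetric_solution_def
    proof
      fix t
      have "rev_time y t = y t" by (simp add: y_sym)
      then show "x t = R (x (- t))"
        by (simp add: x_def apply_time_reversal R1(1) linear_add[OF R1(1)] xh_sym)
    qed
    ultimately show ?thesis by blast
  qed
  show ?thesis
    using main \<open>\<delta> > 0\<close> by (intro exI[of _ "{-\<delta><..<\<delta>}"]) (auto simp: is_interval_convex_1 abs_less_iff)
qed

end
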